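(* Let $X$ be a homogeneous polynomial vector field of degree $2$ on $\mathbb S^2$ and suppose that $p=(0,0,-1)$ is a singularity of $X$; i.e. the system associated to $X$ can be written as $$\begin{aligned}\dot x&=a_1xy+a_2y^2+a_4xz+a_5yz,\\ \dot y&=-a_1x^2-a_2xy+a_7xz+a_8yz,\\ \dot z&=-a_4x^2-a_8y^2-(a_5+a_7)xy,\end{aligned}$$ with real coefficients $a_1,a_2,a_4,a_5,a_7,a_8$. Then $p$ is a center of $X$ (on $\mathbb S^2$) if and only if $a_8=-a_4$, $a_4^2+a_7a_5<0$ and $a_4(a_1^2-a_2^2)+a_1a_2(a_5+a_7)=0$.
   Context: $\mathbb S^2=\{(x,y,z)\in\mathbb R^3: x^2+y^2+z^2=1\}$. A homogeneous polynomial vector field of degree $n$ on $\mathbb S^2$ is a vector field $X=(P,Q,R)$ on $\mathbb R^3$ whose components are real homogeneous polynomials of degree $n$ with $xP+yQ+zR=0$ at all points of $\mathbb S^2$; thus it is tangent to $\mathbb S^2$, and one studies its flow restricted to $\mathbb S^2$. Every homogeneous polynomial vector field of degree $2$ on $\mathbb S^2$ has the form $P=a_1xy+a_2y^2+a_3z^2+a_4xz+a_5yz$, $Q=-a_1x^2-a_2xy+a_6z^2+a_7xz+a_8yz$, $R=-a_4x^2-a_8y^2-(a_5+a_7)xy-a_3xz-a_6yz$; the point $(0,0,-1)$ is a singularity exactly when $a_3=a_6=0$. A singularity $p$ on $\mathbb S^2$ is a center if it has a neighbourhood $U$ in $\mathbb S^2$ such that $U\setminus\{p\}$ is filled by (nonconstant)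 periodic orbits. *)

theory Defs
  imports "HOL-Analysis.Analysis"
begin

abbreviation unit_sphere :: "(real ^ 3) set" where
  "unit_sphere \<equiv> sphere 0 1"

definition homogeneous_polynomial3 :: "nat \<Rightarrow> (real ^ 3 \<Rightarrow> real) \<Rightarrow> bool" where
  "homogeneous_polynomial3 n f \<longleftrightarrow>
     (\<exists>c :: nat \<Rightarrow> nat \<Rightarrow> nat \<Rightarrow> real. \<forall>v.
        f v = (\<Sum>(i, j, k) \<in> {(i, j, k). i + j + k = n}.
                 c i j k * (v $ 1) ^ i * (v $ 2) ^ j * (v $ 3) ^ k))"

definition homogeneous_vector_field_on_sphere :: "nat \<Rightarrow> (real ^ 3 \<Rightarrow> real ^ 3) \<Rightarrow> bool" where
  "homogeneous_vector_field_on_sphere n X \<longleftrightarrow>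
     (\<forall>i. homogeneous_polynomial3 n (\<lambda>v. X v $ i)) \<and>
     (\<forall>v \<in> unit_sphere. v \<bullet> X v = 0)"

definition sphere_singularity :: "(real ^ 3 \<Rightarrow> real ^ 3) \<Rightarrow> real ^ 3 \<Rightarrow> bool" where
  "sphere_singularity X p \<longleftrightarrow> p \<in> unit_sphere \<and> X p = 0"

definition periodic_orbit :: "(real ^ 3 \<Rightarrow> real ^ 3) \<Rightarrow> (real ^ 3) set \<Rightarrow> bool" where
  "periodic_orbit X \<Gamma> \<longleftrightarrow>
     (\<exists>\<gamma> :: real \<Rightarrow> real ^ 3. \<exists>T > 0.
        (\<forall>t. (\<gamma> has_vector_derivative X (\<gamma> t)) (at t)) \<and>
        (\<forall>t. \<gamma> (t + T) = \<gamma> t) \<and>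
        \<not> \<gamma> constant_on UNIV \<and>
        \<Gamma> = range \<gamma>)"

text \<open>The set \<open>U\<close> below is a neighbourhood of \<open>p\<close> relative to the sphere, not necessarily open.
  Since \<open>U\<close> lies in the sphere, so do all the orbits that fill \<open>U - {p}\<close>.\<close>

definition sphere_center :: "(real ^ 3 \<Rightarrow> real ^ 3) \<Rightarrow> real ^ 3 \<Rightarrow> bool" where
  "sphere_center X p \<longleftrightarrow>
     sphere_singularity X p \<and>
     (\<exists>U V. openin (top_of_set unit_sphere) V \<and> p \<in> V \<and> V \<subseteq> U \<and> U \<subseteq> unit_sphere \<and>
        (\<exists>\<O>. (\<forall>\<Gamma> \<in> \<O>. periodic_orbit X \<Gamma>) \<and> U - {p} = \<Union>\<O>))"

definition quadratic_field ::
  "real \<Rightarrow> real \<Rightarrow> real \<Rightarrow> real \<Rightarrow> real \<Rightarrow> real \<Rightarrow> real ^ 3 \<Rightarrow> real ^ 3" where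
  "quadratic_field a1 a2 a4 a5 a7 a8 v =
     (let x = v $ 1; y = v $ 2; z = v $ 3 in
      vector [a1 * x * y + a2 * y\<^sup>2 + a4 * x * z + a5 * y * z,
              - a1 * x\<^sup>2 - a2 * x * y + a7 * x * z + a8 * y * z,
              - a4 * x\<^sup>2 - a8 * y\<^sup>2 - (a5 + a7) * x * y])"

end

theory Submission
  imports Defs
begin

text \<open>With \<open>w = (x, y)\<close>, \<open>l = a1 x + a2 y\<close>, \<open>J w = (y, -x)\<close> and the matrix \<open>A\<close> with rows \<open>(a4, a5)\<close> and
  \<open>(a7, a8)\<close>, the field is \<open>w' = l J w + z A w\<close>, \<open>z' = - w \<bullet> A w\<close>; rotations about the \<open>z\<close>-axis act by
  rotating \<open>l\<close> and conjugating \<open>A\<close>.  If \<open>det A \<le> 0\<close>, then \<open>A\<close> can be made triangular, and a wedge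
  at \<open>p\<close> contains an orbit asymptotic to \<open>p\<close> (or there is a curve of singularities through \<open>p\<close>).
  If \<open>det A > 0\<close> and the trace of \<open>A\<close> is nonzero, a quadratic Lyapunov function excludes periodic orbits.
  If \<open>det A > 0\<close> and the trace vanishes, \<open>A\<close> can be made antidiagonal, and a quartic Lyapunov
  function works unless \<open>a1 a2 (a5 + a7) = 0\<close>, which is the third condition in rotated coordinates.
  Conversely the three conditions say that after a rotation \<open>a1 = a4 = a8 = 0\<close>; then the field is
  reversible under \<open>x \<mapsto> -x\<close>, and every orbit near \<open>p\<close> meets the plane \<open>x = 0\<close> twice, hence closes up.\<close>

section \<open>Global solutions of Lipschitz differential equations\<close>

text \<open>Since \<open>z = -1\<close> at \<open>p\<close>, the linear part there is
  \<open>- A\<close>, so positive eigenvalues of \<open>A\<close> attract. Taylor remainders are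
  avoided: the relevant derivatives are written, or bounded, by forms in \<open>x\<close>,
  \<open>y\<close> whose coefficients are continuous on the whole space, so a strict sign checked at
  \<open>p\<close> persists in a ball. The third condition has an invariant meaning. The expression
  \<open>a2\<^sup>2 * a4 - a1 * a2 * (a5 + a7) + a1\<^sup>2 * a8\<close> is the quadratic form of
  \<open>A\<close> at the vector \<open>(a2, -a1)\<close>, hence unchanged by rotations; for trace
  zero it is minus the third condition. Its vanishing says that \<open>(a2, -a1)\<close> is
  isotropic, and for trace zero this means that a single rotation makes \<open>A\<close>
  antidiagonal and \<open>a1\<close> zero at once. A center supplies its own periodic solutions, so
  existence of solutions is needed only for the converse. Continuous dependence and uniqueness serve
  both directions and come from one Gronwall estimate.\<close>

lemma continuous_has_antiderivative:
  fixes g :: "real \<Rightarrow> 'a::banach"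
  assumes "continuous_on UNIV g"
  shows "\<exists>G. G 0 = 0 \<and> (\<forall>t. (G has_vector_derivative g t) (at t))"
proof -
  \<comment> \<open>One of the two integrals runs over an empty or one-point interval, so
    \<open>G\<close> is the oriented integral from 0 to \<open>t\<close>.\<close>
  define G where "G t = integral {0..t} g - integral {t..0} g" for t :: real
  have int: "g integrable_on {a..b}" for a b
    using assms continuous_on_subset integrable_continuous_real by blast
  have "(G has_vector_derivative g t) (at t)" for t
  proof -
    define m where "m = \<bar>t\<bar> + 1"
    have "((\<lambda>u. integral {-m..u} g) has_vector_derivative g t) (at t within {-m..m})"
      by (rule integral_has_vector_derivative) (use assms continuous_on_subset in \<open>auto simp: m_def\<close>)
    then have "((\<lambda>u. integral {-m..u} g) has_vector_derivative g t) (at t)"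
      by (subst (asm) at_within_interior) (auto simp: m_def)
    then have "((\<lambda>u. integral {-m..u} g - integral {-m..0} g) has_vector_derivative g t - 0) (at t)"
      by (intro derivative_intros)
    then have *: "((\<lambda>u. integral {-m..u} g - integral {-m..0} g) has_vector_derivative g t) (at t)"
      by simp
    have "integral {-m..u} g - integral {-m..0} g = G u" if "u \<in> {-m<..<m}" for u
    proof (cases "u \<ge> 0")
      case True
      then have "integral {-m..0} g + integral {0..u} g = integral {-m..u} g"
        by (intro Henstock_Kurzweil_Integration.integral_combine int) (auto simp: m_def)
      then show ?thesis using True by (cases "u = 0") (auto simp: G_def algebra_simps)
    next
      case False
      then have "integral {-m..u} g + integral {u..0} g = integral {-m..0} g"
        using that by (intro Henstock_Kurzweil_Integration.integral_combine int) auto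
      then show ?thesis using False by (auto simp: G_def algebra_simps)
    qed
    then show ?thesis
      by (intro has_vector_derivative_transform_within_open[OF *, of "{-m<..<m}"]) (auto simp: m_def)
  qed
  then show ?thesis by (intro exI[of _ G]) (auto simp: G_def)
qed

text \<open>One estimate for both needs of the Picard operator: applied to an image it gives
  boundedness in the weighted norm, applied to a difference of images it gives the contraction.
  Integrating \<open>K * exp (c * s)\<close> yields the factor \<open>1 / c\<close>; negative times
  follow by reflection.\<close>

lemma antiderivative_exp_bound:
  fixes G :: "real \<Rightarrow> 'a::real_normed_vector"
  assumes G: "G 0 = 0" "\<And>t. (G has_vector_derivative g t) (at t)"
    and g: "\<And>t. norm (g t) \<le> K * exp (c * \<bar>t\<bar>)" and "c > 0"
  shows "norm (G t) \<le> K / c * exp (c * \<bar>t\<bar>)"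
proof -
  have "norm (g 0) \<le> K" using g[of 0] by simp
  then have K: "K \<ge> 0" using norm_ge_zero[of "g 0"] by linarith
  have half: "norm (H t) \<le> K / c * exp (c * t)"
    if H: "H 0 = 0" "\<And>t. (H has_vector_derivative h t) (at t)"
      and h: "\<And>t. t > 0 \<Longrightarrow> norm (h t) \<le> K * exp (c * t)" and "t \<ge> 0"
    for H h :: "real \<Rightarrow> 'a" and t
  proof (cases "t = 0")
    case False
    have "norm (H t - H 0) \<le> K / c * exp (c * t) - K / c * exp (c * 0)"
    proof (rule differentiable_bound_general)
      show "continuous_on {0..t} H"
        using H(2) by (meson continuous_at_imp_continuous_on has_vector_derivative_continuous)
      show "((\<lambda>s. K / c * exp (c * s)) has_vector_derivative K * exp (c * x)) (at x)" for x
        unfolding has_real_derivative_iff_has_vector_derivative[symmetric]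
        by (rule derivative_eq_intros refl | use \<open>c > 0\<close> in simp)+
    qed (use False \<open>t \<ge> 0\<close> \<open>c > 0\<close> H h in \<open>auto intro!: continuous_intros\<close>)
    then show ?thesis using H K \<open>c > 0\<close> by (smt (verit, best) diff_zero divide_nonneg_pos exp_zero mult_cancel_left2 mult_zero_right)
  qed (use H K \<open>c > 0\<close> in auto)
  show ?thesis
  proof (cases "t \<ge> 0")
    case True
    show ?thesis using half[of G g t] G g True by (metis abs_of_nonneg less_eq_real_def)
  next
    case False
    have "((\<lambda>s. G (- s)) has_vector_derivative - g (- s)) (at s)" for s
    proof -
      have "((G \<circ> uminus) has_vector_derivative (-1) *\<^sub>R g (- s)) (at s)"
        by (rule vector_diff_chain_at) (use G(2) in \<open>auto intro!: derivative_eq_intros\<close>)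
      then show ?thesis by (simp add: o_def)
    qed
    moreover have "norm (- g (- s)) \<le> K * exp (c * s)" if "s > 0" for s
      using g[of "- s"] that by simp
    ultimately show ?thesis using half[of "\<lambda>s. G (- s)" "\<lambda>s. - g (- s)" "- t"] G False by auto
  qed
qed

text \<open>Banach's fixed point theorem for the Picard operator in the norm weighted by
  \<open>exp (- 2 (L + 1) \<bar>t\<bar>)\<close>, in which it is a \<open>1/2\<close>-contraction on the whole line.\<close>

lemma lipschitz_global_solution:
  fixes f :: "'a::banach \<Rightarrow> 'a"
  assumes "L-lipschitz_on UNIV f"
  obtains \<gamma> where "\<gamma> 0 = q" "\<And>t. (\<gamma> has_vector_derivative f (\<gamma> t)) (at t)"
proof -
  \<comment> \<open>Integration gains \<open>1 / c\<close>, so this choice makes the contraction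
    factor \<open>L / c\<close> at most 1/2; the summand 1 keeps \<open>c\<close> positive when
    \<open>L = 0\<close>.\<close>
  define c where "c = 2 * (L + 1)"
  have L: "L \<ge> 0" using assms lipschitz_on_def by blast
  then have c: "c > 0" "L \<le> c / 2" by (auto simp: c_def)
  have lip: "norm (f x - f y) \<le> L * norm (x - y)" for x y
    using lipschitz_onD[OF assms, of x y] by (simp add: dist_norm)
  have contf: "continuous_on UNIV f" by (rule lipschitz_on_continuous_on[OF assms])
  \<comment> \<open>The unknown \<open>u\<close> is the rescaled displacement: the solution sought
    is \<open>q + exp (c * \<bar>t\<bar>) *\<^sub>R u t\<close>, with \<open>u\<close> in the
    complete space of bounded continuous functions.\<close>
  define g where "g u t = f (q + exp (c * \<bar>t\<bar>) *\<^sub>R apply_bcontfun u t)" for u t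
  define I where "I u = (SOME G. G 0 = 0 \<and> (\<forall>t. (G has_vector_derivative g u t) (at t)))" for u
  have "I u 0 = 0 \<and> (\<forall>t. (I u has_vector_derivative g u t) (at t))" for u
  proof -
    have "continuous_on UNIV (g u)"
      unfolding g_def by (intro continuous_on_compose2[OF contf] continuous_intros) auto
    from continuous_has_antiderivative[OF this] show ?thesis unfolding I_def by (rule someI_ex)
  qed
  then have I: "I u 0 = 0" "(I u has_vector_derivative g u t) (at t)" for u t by auto
  define P where "P u = Bcontfun (\<lambda>t. exp (- c * \<bar>t\<bar>) *\<^sub>R I u t)" for u
  have P: "apply_bcontfun (P u) t = exp (- c * \<bar>t\<bar>) *\<^sub>R I u t" for u t
  proof -
    define K where "K = norm (f q) + L * norm u"
    have "norm (g u s) \<le> K * exp (c * \<bar>s\<bar>)" for s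
    proof -
      have "norm (g u s) \<le> norm (f q) + norm (g u s - f q)"
        by (metis add.commute diff_add_cancel norm_triangle_ineq)
      also have "norm (g u s - f q) \<le> L * (exp (c * \<bar>s\<bar>) * norm (apply_bcontfun u s))"
        using lip[of "q + exp (c * \<bar>s\<bar>) *\<^sub>R apply_bcontfun u s" q] by (simp add: g_def)
      also have "\<dots> \<le> L * (exp (c * \<bar>s\<bar>) * norm u)"
        using L norm_bounded by (intro mult_left_mono) auto
      also have "norm (f q) \<le> norm (f q) * exp (c * \<bar>s\<bar>)"
        using c by (simp add: mult_le_cancel_left1)
      finally show ?thesis by (simp add: K_def algebra_simps)
    qed
    then have "norm (I u s) \<le> K / c * exp (c * \<bar>s\<bar>)" for s
      by (rule antiderivative_exp_bound[OF I]) (use c in auto)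
    then have "norm (exp (- c * \<bar>s\<bar>) *\<^sub>R I u s) \<le> K / c" for s
      by (simp add: exp_minus field_simps)
    moreover have "continuous_on UNIV (\<lambda>s. exp (- c * \<bar>s\<bar>) *\<^sub>R I u s)"
      using I(2) by (intro continuous_intros)
        (meson continuous_at_imp_continuous_on has_vector_derivative_continuous)
    ultimately have "(\<lambda>s. exp (- c * \<bar>s\<bar>) *\<^sub>R I u s) \<in> bcontfun" using bcontfun_normI by blast
    then show ?thesis by (simp add: P_def Bcontfun_inverse)
  qed
  have "dist (P u) (P v) \<le> 1/2 * dist u v" for u v
  proof (rule dist_bound)
    fix t
    have "norm (g u s - g v s) \<le> L * dist u v * exp (c * \<bar>s\<bar>)" for s
    proof -
      have "norm (g u s - g v s) \<le> L * (exp (c * \<bar>s\<bar>) * dist (apply_bcontfun u s) (apply_bcontfun v s))"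
        using lip[of "q + exp (c * \<bar>s\<bar>) *\<^sub>R apply_bcontfun u s" "q + exp (c * \<bar>s\<bar>) *\<^sub>R apply_bcontfun v s"]
        by (simp add: g_def dist_norm flip: scaleR_diff_right)
      also have "\<dots> \<le> L * (exp (c * \<bar>s\<bar>) * dist u v)"
        using L dist_bounded by (intro mult_left_mono) auto
      finally show ?thesis by (simp add: algebra_simps)
    qed
    then have "norm (I u t - I v t) \<le> L * dist u v / c * exp (c * \<bar>t\<bar>)"
      by (intro antiderivative_exp_bound[where G = "\<lambda>t. I u t - I v t" and g = "\<lambda>s. g u s - g v s"])
        (use c I in \<open>auto intro!: derivative_eq_intros\<close>)
    then have "dist (apply_bcontfun (P u) t) (apply_bcontfun (P v) t) \<le> L * dist u v / c"
      unfolding P dist_norm by (simp flip: scaleR_diff_right) (simp add: exp_minus field_simps)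
    also have "\<dots> \<le> 1/2 * dist u v"
      using c mult_right_mono[OF c(2), of "dist u v"] by (simp add: field_simps)
    finally show "dist (apply_bcontfun (P u) t) (apply_bcontfun (P v) t) \<le> 1/2 * dist u v" .
  qed
  then obtain u where u: "P u = u"
    using banach_fix_type[of "1/2" P] by auto
  define \<gamma> where "\<gamma> t = q + I u t" for t
  have "exp (c * \<bar>t\<bar>) *\<^sub>R apply_bcontfun u t = I u t" for t
    using P[of u t] u by (simp add: exp_minus)
  then have "g u t = f (\<gamma> t)" for t by (simp add: g_def \<gamma>_def)
  then have "(\<gamma> has_vector_derivative f (\<gamma> t)) (at t)" for t
    unfolding \<gamma>_def using I(2)[of u t] by (auto intro!: derivative_eq_intros)
  then show ?thesis using that[of \<gamma>] I(1) by (simp add: \<gamma>_def)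
qed

section \<open>Centers and solutions on the sphere\<close>

definition sphere_solution :: "(real ^ 3 \<Rightarrow> real ^ 3) \<Rightarrow> (real \<Rightarrow> real ^ 3) \<Rightarrow> bool" where
  "sphere_solution X \<gamma> \<longleftrightarrow>
     (\<forall>t. (\<gamma> has_vector_derivative X (\<gamma> t)) (at t) \<and> \<gamma> t \<in> unit_sphere)"

definition periodic_through :: "(real ^ 3 \<Rightarrow> real ^ 3) \<Rightarrow> real ^ 3 \<Rightarrow> real ^ 3 \<Rightarrow> bool" where
  "periodic_through X p q \<longleftrightarrow>
     (\<exists>\<gamma>. \<exists>T > 0. sphere_solution X \<gamma> \<and> \<gamma> 0 = q \<and> (\<forall>t. \<gamma> (t + T) = \<gamma> t) \<and>
        \<not> \<gamma> constant_on UNIV \<and> (\<forall>t. \<gamma> t \<noteq> p))"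

lemma sphere_solution_derivative:
  "sphere_solution X \<gamma> \<Longrightarrow> (\<gamma> has_vector_derivative X (\<gamma> t)) (at t)"
  by (simp add: sphere_solution_def)

lemma sphere_solution_mem: "sphere_solution X \<gamma> \<Longrightarrow> \<gamma> t \<in> unit_sphere"
  by (simp add: sphere_solution_def)

lemma sphere_solution_continuous: "sphere_solution X \<gamma> \<Longrightarrow> continuous_on A \<gamma>"
  by (meson continuous_at_imp_continuous_on has_vector_derivative_continuous sphere_solution_derivative)

lemma sphere_solution_inner:
  assumes "sphere_solution X \<gamma>"
  shows "((\<lambda>t. a \<bullet> \<gamma> t) has_real_derivative a \<bullet> X (\<gamma> t)) (at t)"
  using bounded_linear.has_vector_derivative[OF bounded_linear_inner_right
      sphere_solution_derivative[OF assms]]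
  by (simp add: has_real_derivative_iff_has_vector_derivative)

lemma sphere_solution_component:
  assumes "sphere_solution X \<gamma>"
  shows "((\<lambda>t. \<gamma> t $ i) has_real_derivative X (\<gamma> t) $ i) (at t)"
  using bounded_linear.has_vector_derivative[OF bounded_linear_vec_nth
      sphere_solution_derivative[OF assms]]
  by (simp add: has_real_derivative_iff_has_vector_derivative)

lemma sphere_solution_shift:
  assumes "sphere_solution X \<gamma>"
  shows "sphere_solution X (\<lambda>t. \<gamma> (t + s))"
proof -
  have "((\<lambda>t. \<gamma> (t + s)) has_vector_derivative X (\<gamma> (t + s))) (at t)" for t
  proof -
    have "((\<gamma> \<circ> (\<lambda>t. t + s)) has_vector_derivative 1 *\<^sub>R X (\<gamma> (t + s))) (at t)"
      by (rule vector_diff_chain_at)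
        (use sphere_solution_derivative[OF assms] in \<open>auto intro!: derivative_eq_intros\<close>)
    then show ?thesis by (simp add: o_def)
  qed
  then show ?thesis using assms by (simp add: sphere_solution_def)
qed

text \<open>With \<open>S\<close> the identity this is plain time reversal; with \<open>S\<close> a
  reflection it is the symmetry of a reversible field.\<close>

lemma sphere_solution_image_reverse:
  assumes "sphere_solution X \<gamma>" "bounded_linear S" "\<And>v. v \<in> unit_sphere \<Longrightarrow> S v \<in> unit_sphere"
    and "\<And>v. Y (S v) = - S (X v)"
  shows "sphere_solution Y (\<lambda>t. S (\<gamma> (- t)))"
proof -
  have "((\<lambda>t. S (\<gamma> (- t))) has_vector_derivative Y (S (\<gamma> (- t)))) (at t)" for t
  proof -
    have "((\<gamma> \<circ> uminus) has_vector_derivative (-1) *\<^sub>R X (\<gamma> (- t))) (at t)"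
      by (rule vector_diff_chain_at)
        (use sphere_solution_derivative[OF assms(1)] in \<open>auto intro!: derivative_eq_intros\<close>)
    from bounded_linear.has_vector_derivative[OF assms(2) this]
    show ?thesis by (simp add: o_def assms(4) linear_neg[OF bounded_linear.linear[OF assms(2)]])
  qed
  then show ?thesis using assms by (simp add: sphere_solution_def)
qed

lemma sphere_solution_image:
  assumes "sphere_solution X \<gamma>" "bounded_linear S" "\<And>v. v \<in> unit_sphere \<Longrightarrow> S v \<in> unit_sphere"
    and "\<And>v. Y (S v) = S (X v)"
  shows "sphere_solution Y (\<lambda>t. S (\<gamma> t))"
  using assms bounded_linear.has_vector_derivative[OF assms(2) sphere_solution_derivative[OF assms(1)]]
  by (simp add: sphere_solution_def)

text \<open>Gronwall's inequality: the squared distance times \<open>exp (- 2 * L * t)\<close> has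
  nonpositive derivative by Cauchy-Schwarz. A Lipschitz bound on the sphere suffices, as both
  solutions stay there.\<close>

lemma sphere_solution_growth:
  assumes X: "L-lipschitz_on unit_sphere X"
    and sol: "sphere_solution X \<alpha>" "sphere_solution X \<beta>" and "t \<ge> 0"
  shows "dist (\<alpha> t) (\<beta> t) \<le> exp (L * t) * dist (\<alpha> 0) (\<beta> 0)"
proof -
  define w where "w t = \<alpha> t - \<beta> t" for t
  define D where "D t = w t \<bullet> w t * exp (- 2 * L * t)" for t
  have w: "(w has_vector_derivative X (\<alpha> t) - X (\<beta> t)) (at t)" for t
    unfolding w_def by (intro derivative_intros sphere_solution_derivative sol)
  have le: "w t \<bullet> (X (\<alpha> t) - X (\<beta> t)) \<le> L * (w t \<bullet> w t)" for t
  proof -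
    have "w t \<bullet> (X (\<alpha> t) - X (\<beta> t)) \<le> norm (w t) * norm (X (\<alpha> t) - X (\<beta> t))"
      by (rule norm_cauchy_schwarz)
    also have "\<dots> \<le> norm (w t) * (L * norm (w t))"
      using lipschitz_onD[OF X sphere_solution_mem[OF sol(1)] sphere_solution_mem[OF sol(2)], of t t]
      by (intro mult_left_mono) (auto simp: w_def dist_norm)
    finally show ?thesis by (simp add: dot_square_norm power2_eq_square algebra_simps)
  qed
  have "D t \<le> D 0"
  proof (rule DERIV_nonpos_imp_nonincreasing[OF \<open>t \<ge> 0\<close>])
    fix s
    have ww: "((\<lambda>s. w s \<bullet> w s) has_real_derivative 2 * (w s \<bullet> (X (\<alpha> s) - X (\<beta> s)))) (at s)"
    proof -
      have "((\<lambda>s. w s \<bullet> w s) has_derivative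
          (\<lambda>h. w s \<bullet> (h *\<^sub>R (X (\<alpha> s) - X (\<beta> s))) + (h *\<^sub>R (X (\<alpha> s) - X (\<beta> s))) \<bullet> w s)) (at s)"
        by (rule has_derivative_inner) (use w[of s] in \<open>simp_all add: has_vector_derivative_def\<close>)
      then show ?thesis
        unfolding has_field_derivative_def
        by (rule has_derivative_eq_rhs) (simp add: fun_eq_iff inner_commute)
    qed
    have "(D has_real_derivative
        2 * (w s \<bullet> (X (\<alpha> s) - X (\<beta> s)) - L * (w s \<bullet> w s)) * exp (- 2 * L * s)) (at s)"
      unfolding D_def by (rule derivative_eq_intros ww refl)+ (simp add: algebra_simps)
    moreover have "2 * (w s \<bullet> (X (\<alpha> s) - X (\<beta> s)) - L * (w s \<bullet> w s)) * exp (- 2 * L * s) \<le> 0"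
      using le[of s] by (simp add: mult_nonpos_nonneg)
    ultimately show "\<exists>y. (D has_real_derivative y) (at s) \<and> y \<le> 0" by blast
  qed
  then have le0: "(norm (w t))\<^sup>2 * exp (- 2 * L * t) \<le> (norm (w 0))\<^sup>2"
    by (simp add: D_def dot_square_norm)
  have e: "exp (- 2 * L * t) * (exp (L * t))\<^sup>2 = 1"
    by (simp add: power2_eq_square flip: exp_add)
  have "(norm (w t))\<^sup>2 = (norm (w t))\<^sup>2 * exp (- 2 * L * t) * (exp (L * t))\<^sup>2"
    using e by (simp only: mult.assoc mult_1_right)
  also have "\<dots> \<le> (norm (w 0))\<^sup>2 * (exp (L * t))\<^sup>2"
    by (intro mult_right_mono le0) simp
  finally have "(norm (w t))\<^sup>2 \<le> (exp (L * t) * norm (w 0))\<^sup>2"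
    by (simp add: power_mult_distrib mult.commute)
  then have "norm (w t) \<le> exp (L * t) * norm (w 0)"
    by (rule power2_le_imp_le) simp
  then show ?thesis by (simp add: w_def dist_norm)
qed

lemma lipschitz_on_uminus:
  fixes X :: "'a::metric_space \<Rightarrow> 'b::real_normed_vector"
  shows "L-lipschitz_on A X \<Longrightarrow> L-lipschitz_on A (\<lambda>v. - X v)"
  by (simp add: lipschitz_on_def dist_minus)

lemma sphere_solution_unique:
  assumes X: "L-lipschitz_on unit_sphere X"
    and sol: "sphere_solution X \<alpha>" "sphere_solution X \<beta>" and eq: "\<alpha> s = \<beta> s"
  shows "\<alpha> t = \<beta> t"
proof (cases "t \<ge> s")
  case True
  have "dist (\<alpha> ((t - s) + s)) (\<beta> ((t - s) + s)) \<le> exp (L * (t - s)) * dist (\<alpha> (0 + s)) (\<beta> (0 + s))"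
    by (rule sphere_solution_growth[OF X]) (use True sol sphere_solution_shift in auto)
  then show ?thesis using eq by simp
next
  case False
  have "sphere_solution (\<lambda>v. - X v) (\<lambda>u. \<gamma> (- u + s))" if "sphere_solution X \<gamma>" for \<gamma>
    using sphere_solution_image_reverse[OF sphere_solution_shift[OF that, of s], of "\<lambda>v. v"]
    by auto
  then have "dist (\<alpha> (- (s - t) + s)) (\<beta> (- (s - t) + s)) \<le> exp (L * (s - t)) * dist (\<alpha> (- 0 + s)) (\<beta> (- 0 + s))"
    by (intro sphere_solution_growth[OF lipschitz_on_uminus[OF X]]) (use False sol in auto)
  then show ?thesis using eq by simp
qed

text \<open>Trades the family of orbits for a radius. In the return direction \<open>U\<close>
  consists of \<open>p\<close> and all periodic orbits in the punctured sphere; orbits may leave the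
  ball, because only \<open>V\<close> has to lie inside \<open>U\<close>.\<close>

lemma sphere_center_iff:
  "sphere_center X p \<longleftrightarrow> sphere_singularity X p \<and>
     (\<exists>\<rho>>0. \<forall>q\<in>unit_sphere. q \<noteq> p \<longrightarrow> dist q p < \<rho> \<longrightarrow> periodic_through X p q)"
    (is "_ \<longleftrightarrow> _ \<and> (\<exists>\<rho>>0. ?P \<rho>)")
proof (intro iffI conjI)
  assume c: "sphere_center X p"
  then show "sphere_singularity X p" unfolding sphere_center_def by (rule conjunct1)
  from c[unfolded sphere_center_def, THEN conjunct2]
  obtain U V \<O> where UV: "openin (top_of_set unit_sphere) V" "p \<in> V" "V \<subseteq> U" "U \<subseteq> unit_sphere"
    and \<O>: "\<forall>\<Gamma>\<in>\<O>. periodic_orbit X \<Gamma>" "U - {p} = \<Union>\<O>"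
    by (elim exE conjE)
  obtain \<rho> where \<rho>: "\<rho> > 0" "\<And>q. q \<in> unit_sphere \<Longrightarrow> dist q p < \<rho> \<Longrightarrow> q \<in> V"
  proof -
    obtain e where "e > 0" "ball p e \<inter> unit_sphere \<subseteq> V"
      using UV(1,2) unfolding openin_contains_ball by blast
    then show ?thesis by (intro that[of e]) (auto simp: dist_commute)
  qed
  have "periodic_through X p q" if "q \<in> unit_sphere" "q \<noteq> p" "dist q p < \<rho>" for q
  proof -
    have "q \<in> U - {p}" using that \<rho>(2) UV(3) by blast
    then obtain \<Gamma> where \<Gamma>: "\<Gamma> \<in> \<O>" "q \<in> \<Gamma>" unfolding \<O>(2) by (elim UnionE)
    then have sub: "\<Gamma> \<subseteq> U - {p}" unfolding \<O>(2) by (intro Union_upper)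
    obtain \<gamma> T where \<gamma>: "\<And>t. (\<gamma> has_vector_derivative X (\<gamma> t)) (at t)" "T > 0"
      "\<And>t. \<gamma> (t + T) = \<gamma> t" "\<not> \<gamma> constant_on UNIV" "\<Gamma> = range \<gamma>"
      using bspec[OF \<O>(1) \<Gamma>(1)] unfolding periodic_orbit_def by (elim exE conjE) blast
    obtain s where s: "q = \<gamma> s" using \<Gamma>(2) \<gamma>(5) by auto
    have mem: "\<gamma> t \<in> unit_sphere \<and> \<gamma> t \<noteq> p" for t using sub UV(4) \<gamma>(5) by blast
    have "sphere_solution X (\<lambda>t. \<gamma> (t + s))"
      by (rule sphere_solution_shift) (use \<gamma>(1) mem in \<open>simp add: sphere_solution_def\<close>)
    moreover have "\<not> (\<lambda>t. \<gamma> (t + s)) constant_on UNIV"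
    proof
      assume "(\<lambda>t. \<gamma> (t + s)) constant_on UNIV"
      then obtain c where "\<And>t. \<gamma> (t + s) = c" unfolding constant_on_def by auto
      then have "\<gamma> t = c" for t by (metis diff_add_cancel)
      then show False using \<gamma>(4) unfolding constant_on_def by auto
    qed
    moreover have "\<gamma> (t + T + s) = \<gamma> (t + s)" for t using \<gamma>(3)[of "t + s"] by (simp add: ac_simps)
    ultimately show ?thesis unfolding periodic_through_def using \<gamma>(2) mem s
      by (intro exI[of _ "\<lambda>t. \<gamma> (t + s)"] exI[of _ T]) auto
  qed
  then show "\<exists>\<rho>>0. ?P \<rho>" using \<rho>(1) by blast
next
  assume "sphere_singularity X p \<and> (\<exists>\<rho>>0. ?P \<rho>)"
  then obtain \<rho> where sing: "sphere_singularity X p" and \<rho>: "\<rho> > 0" "?P \<rho>"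
    by (elim exE conjE)
  define V where "V = unit_sphere \<inter> ball p \<rho>"
  define \<O> where "\<O> = {\<Gamma>. periodic_orbit X \<Gamma> \<and> \<Gamma> \<subseteq> unit_sphere - {p}}"
  have p: "p \<in> unit_sphere" using sing by (simp add: sphere_singularity_def)
  have "q \<in> \<Union>\<O>" if "q \<in> V" "q \<noteq> p" for q
  proof -
    have "periodic_through X p q" using that \<rho>(2) by (auto simp: V_def dist_commute)
    then obtain \<gamma> T where \<gamma>: "T > 0" "sphere_solution X \<gamma>" "\<gamma> 0 = q" "\<forall>t. \<gamma> (t + T) = \<gamma> t"
      "\<not> \<gamma> constant_on UNIV" "\<forall>t. \<gamma> t \<noteq> p"
      unfolding periodic_through_def by blast
    have "periodic_orbit X (range \<gamma>)"
      unfolding periodic_orbit_def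
      by (intro exI[of _ \<gamma>] exI[of _ T] conjI) (use \<gamma> in \<open>simp_all add: sphere_solution_def\<close>)
    moreover have "range \<gamma> \<subseteq> unit_sphere - {p}"
      using \<gamma>(2,6) sphere_solution_mem by blast
    ultimately have "range \<gamma> \<in> \<O>" by (simp add: \<O>_def)
    then show ?thesis using \<gamma>(3) by blast
  qed
  then have "V \<subseteq> insert p (\<Union>\<O>)" by auto
  moreover have "insert p (\<Union>\<O>) - {p} = \<Union>\<O>" "insert p (\<Union>\<O>) \<subseteq> unit_sphere"
    using p unfolding \<O>_def by blast+
  moreover have "openin (top_of_set unit_sphere) V" "p \<in> V"
    using p \<rho>(1) by (auto simp: V_def openin_open)
  moreover have "\<forall>\<Gamma>\<in>\<O>. periodic_orbit X \<Gamma>" by (simp add: \<O>_def)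
  ultimately show "sphere_center X p"
    unfolding sphere_center_def using sing by blast
qed

text \<open>A linear isometry fixing \<open>p\<close> preserves distances to \<open>p\<close>, so
  the same radius works for the conjugate field.\<close>

lemma sphere_center_image:
  assumes S: "bounded_linear S" "bounded_linear S'" "\<And>v. norm (S v) = norm v"
      "\<And>v. S (S' v) = v" "\<And>v. S' (S v) = v" "S p = p"
    and Y: "\<And>v. Y (S v) = S (X v)" and center: "sphere_center X p"
  shows "sphere_center Y p"
proof -
  obtain \<rho> where p: "p \<in> unit_sphere" "X p = 0" and \<rho>: "\<rho> > 0"
    "\<And>q. q \<in> unit_sphere \<Longrightarrow> q \<noteq> p \<Longrightarrow> dist q p < \<rho> \<Longrightarrow> periodic_through X p q"
    using center unfolding sphere_center_iff sphere_singularity_def by blast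
  have "Y p = 0" using Y[of p] p S by (simp add: linear_0[OF bounded_linear.linear])
  moreover have "periodic_through Y p q" if q: "q \<in> unit_sphere" "q \<noteq> p" "dist q p < \<rho>" for q
  proof -
    have "norm (S' v) = norm v" for v using S(3)[of "S' v"] S(4) by simp
    moreover have "S' p = p" using S(5)[of p] S(6) by simp
    moreover have "S' q - S' p = S' (q - p)" using S(2) by (simp add: linear_diff bounded_linear.linear)
    moreover have "S' q \<noteq> p" using q(2) S(4,6) by metis
    ultimately have "periodic_through X p (S' q)"
      using q by (intro \<rho>) (simp_all add: dist_norm)
    then obtain \<gamma> T where \<gamma>: "T > 0" "sphere_solution X \<gamma>" "\<gamma> 0 = S' q" "\<forall>t. \<gamma> (t + T) = \<gamma> t"
      "\<not> \<gamma> constant_on UNIV" "\<forall>t. \<gamma> t \<noteq> p"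
      unfolding periodic_through_def by blast
    have "sphere_solution Y (\<lambda>t. S (\<gamma> t))"
      by (rule sphere_solution_image[OF \<gamma>(2) S(1)]) (use S Y in auto)
    moreover have "\<not> (\<lambda>t. S (\<gamma> t)) constant_on UNIV"
      using \<gamma>(5) S(5) unfolding constant_on_def by metis
    moreover have "S (\<gamma> t) \<noteq> p" for t using \<gamma>(6) S(5,6) by metis
    ultimately show ?thesis
      unfolding periodic_through_def using \<gamma> S(4) by (intro exI[of _ "\<lambda>t. S (\<gamma> t)"] exI[of _ T]) auto
  qed
  ultimately show ?thesis unfolding sphere_center_iff sphere_singularity_def using p \<rho>(1) by blast
qed

lemma sphere_center_uminus:
  assumes "sphere_center X p"
  shows "sphere_center (\<lambda>v. - X v) p"
proof -
  have "periodic_through (\<lambda>v. - X v) p q" if per: "periodic_through X p q" for q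
  proof -
    obtain \<gamma> T where \<gamma>: "T > 0" "sphere_solution X \<gamma>" "\<gamma> 0 = q" "\<forall>t. \<gamma> (t + T) = \<gamma> t"
      "\<not> \<gamma> constant_on UNIV" "\<forall>t. \<gamma> t \<noteq> p"
      using per unfolding periodic_through_def by blast
    have "sphere_solution (\<lambda>v. - X v) (\<lambda>t. \<gamma> (- t))"
      using sphere_solution_image_reverse[OF \<gamma>(2), of "\<lambda>v. v"] by auto
    moreover have "\<not> (\<lambda>t. \<gamma> (- t)) constant_on UNIV"
      using \<gamma>(5) unfolding constant_on_def by (metis UNIV_I add.inverse_inverse)
    moreover have "\<gamma> (- (t + T)) = \<gamma> (- t)" for t
      using \<gamma>(4)[rule_format, of "- (t + T)"] by simp
    ultimately show ?thesis
      unfolding periodic_through_def using \<gamma> by (intro exI[of _ "\<lambda>t. \<gamma> (- t)"] exI[of _ T]) auto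
  qed
  then show ?thesis
    using assms unfolding sphere_center_iff sphere_singularity_def by simp blast
qed

section \<open>Obstructions to a center\<close>

lemma first_hitting_time:
  fixes f :: "real \<Rightarrow> real"
  assumes f: "continuous_on UNIV f" and "f 0 < c" "c \<le> f t" "0 \<le> t"
  shows "\<exists>u>0. u \<le> t \<and> f u = c \<and> (\<forall>s. 0 \<le> s \<longrightarrow> s < u \<longrightarrow> f s < c)"
proof -
  define A where "A = {0..t} \<inter> f -` {c}"
  have cont: "continuous_on B f" for B using f continuous_on_subset by blast
  have "compact A"
    unfolding A_def by (intro compact_Int_closed compact_Icc closed_vimage f closed_singleton)
  moreover have "A \<noteq> {}"
  proof -
    obtain x where "0 \<le> x" "x \<le> t" "f x = c"
      using IVT'[OF less_imp_le[OF assms(2)] assms(3,4) cont] by blast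
    then show ?thesis by (auto simp: A_def)
  qed
  ultimately obtain u where u: "u \<in> A" "\<And>s. s \<in> A \<Longrightarrow> u \<le> s"
    using compact_attains_inf by metis
  have "f s < c" if s: "0 \<le> s" "s < u" for s
  proof (rule ccontr)
    assume "\<not> f s < c"
    then have "c \<le> f s" by simp
    then obtain x where "0 \<le> x" "x \<le> s" "f x = c"
      using IVT'[OF less_imp_le[OF assms(2)] _ s(1) cont] by blast
    then have "x \<in> A" using s u(1) by (auto simp: A_def)
    then show False using u(2)[of x] \<open>x \<le> s\<close> s by auto
  qed
  moreover have "u \<noteq> 0" using u(1) assms(2) by (auto simp: A_def)
  ultimately show ?thesis using u(1) by (intro exI[of _ u]) (auto simp: A_def)
qed

text \<open>A connected set with at least two points has no isolated point; here \<open>- p\<close>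
  is the second point.\<close>

lemma sphere_points_near:
  fixes p :: "real ^ 3"
  assumes "p \<in> unit_sphere" "\<epsilon> > 0"
  obtains q where "q \<in> unit_sphere" "q \<noteq> p" "dist q p < \<epsilon>"
proof -
  have "- p \<noteq> p"
  proof
    assume "- p = p"
    then have "2 *\<^sub>R p = 0" by (metis ab_left_minus scaleR_2)
    then have "p = 0" by simp
    then show False using assms(1) by simp
  qed
  then have "\<nexists>a. unit_sphere = {a}" using assms(1)
    by (metis mem_sphere_0 norm_minus_cancel singletonD)
  moreover have "connected (unit_sphere :: (real ^ 3) set)"
    by (rule connected_sphere) simp
  ultimately have "p islimpt unit_sphere" by (intro connected_imp_perfect assms(1)) auto
  then show ?thesis using assms(2) that by (auto simp: islimpt_approachable)
qed

text \<open>An orbit starting where \<open>F\<close> is below its minimum \<open>m\<close> at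
  distance \<open>r\<close> is trapped, since reaching that distance would require \<open>F\<close>
  to rise. Hence \<open>F\<close> decreases strictly over a whole period, which periodicity
  forbids.\<close>

lemma lyapunov_not_center:
  fixes F F' :: "real ^ 3 \<Rightarrow> real"
  assumes deriv: "\<And>\<gamma> t. sphere_solution X \<gamma> \<Longrightarrow>
      ((\<lambda>t. F (\<gamma> t)) has_real_derivative F' (\<gamma> t)) (at t)"
    and F: "continuous_on UNIV F" "F p = 0" and "r > 0"
    and near: "\<And>q. q \<in> unit_sphere \<Longrightarrow> q \<noteq> p \<Longrightarrow> dist q p \<le> r \<Longrightarrow> F q > 0 \<and> F' q < 0"
  shows "\<not> sphere_center X p"
proof
  assume "sphere_center X p"
  then obtain \<rho> where p: "p \<in> unit_sphere" and \<rho>: "\<rho> > 0"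
    "\<And>q. q \<in> unit_sphere \<Longrightarrow> q \<noteq> p \<Longrightarrow> dist q p < \<rho> \<Longrightarrow> periodic_through X p q"
    unfolding sphere_center_iff sphere_singularity_def by blast
  define K where "K = unit_sphere \<inter> sphere p r"
  have "\<exists>m>0. \<forall>q\<in>K. m \<le> F q"
  proof (cases "K = {}")
    case False
    have "compact K" unfolding K_def by (intro compact_Int_closed) auto
    then obtain k where k: "k \<in> K" "\<And>q. q \<in> K \<Longrightarrow> F k \<le> F q"
      using continuous_attains_inf[OF _ False continuous_on_subset[OF F(1)]] by blast
    have "F k > 0" using near[of k] k(1) \<open>r > 0\<close> by (auto simp: K_def dist_commute)
    then show ?thesis using k(2) by blast
  qed (auto intro: exI[of _ 1])
  then obtain m where m: "m > 0" "\<And>q. q \<in> K \<Longrightarrow> m \<le> F q" by blast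
  obtain d where d: "d > 0" "\<And>q. dist q p < d \<Longrightarrow> F q < m"
  proof -
    have "open (F -` {..<m})" by (rule open_vimage[OF open_lessThan F(1)])
    moreover have "p \<in> F -` {..<m}" using F(2) m(1) by simp
    ultimately show ?thesis using that unfolding open_dist by blast
  qed
  obtain q where q: "q \<in> unit_sphere" "q \<noteq> p" "dist q p < min d (min r \<rho>)"
    by (rule sphere_points_near[OF p, of "min d (min r \<rho>)"]) (use d \<rho> \<open>r > 0\<close> in auto)
  then have "periodic_through X p q" by (intro \<rho>(2)) simp_all
  then obtain \<gamma> T where \<gamma>: "T > 0" "sphere_solution X \<gamma>" "\<gamma> 0 = q" "\<forall>t. \<gamma> (t + T) = \<gamma> t"
    "\<forall>t. \<gamma> t \<noteq> p"
    unfolding periodic_through_def by blast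
  note mem = sphere_solution_mem[OF \<gamma>(2)]
  have cont: "continuous_on A (\<lambda>t. F (\<gamma> t))" for A
    by (rule continuous_on_compose2[OF F(1) sphere_solution_continuous[OF \<gamma>(2)]]) auto
  have dec: "F (\<gamma> t) < F (\<gamma> 0)" if "t > 0" "\<And>s. 0 \<le> s \<Longrightarrow> s < t \<Longrightarrow> dist (\<gamma> s) p \<le> r" for t
  proof (rule DERIV_neg_imp_decreasing_open[OF that(1) _ cont])
    fix s assume "0 < s" "s < t"
    then have "F' (\<gamma> s) < 0" using near[OF mem, of s] \<gamma>(5) that(2) by simp
    then show "\<exists>y. ((\<lambda>t. F (\<gamma> t)) has_real_derivative y) (at s) \<and> y < 0"
      using deriv[OF \<gamma>(2)] by blast
  qed
  have "dist (\<gamma> t) p < r" if "t \<ge> 0" for t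
  proof (rule ccontr)
    assume "\<not> dist (\<gamma> t) p < r"
    then have le: "r \<le> dist (\<gamma> t) p" and lt: "dist (\<gamma> 0) p < r" using q(3) \<gamma>(3) by simp_all
    obtain u where u: "u > 0" "u \<le> t" "dist (\<gamma> u) p = r"
      "\<And>s. 0 \<le> s \<Longrightarrow> s < u \<Longrightarrow> dist (\<gamma> s) p < r"
      using first_hitting_time[OF continuous_on_dist[OF sphere_solution_continuous[OF \<gamma>(2)]
            continuous_on_const] lt le \<open>t \<ge> 0\<close>] by blast
    then have "F (\<gamma> u) < F q" using dec[of u] \<gamma>(3) by (simp add: less_imp_le)
    also have "F q < m" using d(2) q(3) by simp
    also have "m \<le> F (\<gamma> u)"
      using m(2)[of "\<gamma> u"] u(3) mem[of u] by (simp add: K_def dist_commute)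
    finally show False by simp
  qed
  then have "F (\<gamma> T) < F (\<gamma> 0)" using dec[of T] \<gamma>(1) by (simp add: less_imp_le)
  then show False using \<gamma>(4)[rule_format, of 0] by simp
qed

lemma immediate_exit:
  fixes f g :: "real \<Rightarrow> real"
  assumes f: "(f has_real_derivative l) (at u)" "l < 0" "f u = 0"
    and g: "continuous_on UNIV g" "g u > 0" "\<And>s. 0 \<le> s \<Longrightarrow> s < u \<Longrightarrow> g s > 0" and "u \<ge> 0"
  shows "\<exists>t\<ge>0. f t < 0 \<and> (\<forall>s\<in>{0..t}. g s > 0)"
proof -
  obtain d where d: "d > 0" "\<And>h. 0 < h \<Longrightarrow> h < d \<Longrightarrow> f (u + h) < f u"
    using DERIV_neg_dec_right[OF f(1,2)] by blast
  obtain e where e: "e > 0" "\<And>s. dist s u < e \<Longrightarrow> g s > 0"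
  proof -
    have "open (g -` {0<..})" by (rule open_vimage[OF open_greaterThan g(1)])
    moreover have "u \<in> g -` {0<..}" using g(2) by simp
    ultimately show ?thesis using that unfolding open_dist by blast
  qed
  define t where "t = u + min d e / 2"
  have "f t < 0" using d(2)[of "min d e / 2"] d(1) e(1) f(3) by (simp add: t_def min_def)
  moreover have "g s > 0" if "s \<in> {0..t}" for s
  proof (cases "s < u")
    case False
    then show ?thesis using that d(1) e(1) by (intro e(2)) (auto simp: t_def dist_real_def)
  qed (use g(3) that in auto)
  ultimately show ?thesis using d(1) e(1) \<open>u \<ge> 0\<close> by (intro exI[of _ t]) (auto simp: t_def)
qed

text \<open>Three ways of not leaving through a single face are excluded. Staying for a whole period
  contradicts the decrease of \<open>a + b\<close>; the outer boundary is out of reach because the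
  distance is at most \<open>K\<close> times this decreasing quantity; and both faces meet only at
  \<open>p\<close> by the same bound.\<close>

lemma wedge_exit:
  assumes sol: "sphere_solution X \<gamma>" and T: "T > 0" "\<gamma> T = \<gamma> 0" and p: "\<And>t. \<gamma> t \<noteq> p"
    and wedge: "\<And>q. q \<in> unit_sphere \<Longrightarrow> q \<noteq> p \<Longrightarrow> dist q p \<le> r \<Longrightarrow> 0 \<le> a \<bullet> q \<Longrightarrow> 0 \<le> b \<bullet> q \<Longrightarrow>
        (a \<bullet> q = 0 \<longrightarrow> a \<bullet> X q < 0) \<and> (b \<bullet> q = 0 \<longrightarrow> b \<bullet> X q < 0) \<and>
        (0 < a \<bullet> q \<longrightarrow> 0 < b \<bullet> q \<longrightarrow> (a + b) \<bullet> X q < 0) \<and> dist q p \<le> K * ((a + b) \<bullet> q)"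
    and start: "0 \<le> a \<bullet> \<gamma> 0" "0 \<le> b \<bullet> \<gamma> 0" "dist (\<gamma> 0) p \<le> r" "K * ((a + b) \<bullet> \<gamma> 0) < r" and "K \<ge> 0"
  shows "(\<exists>t\<ge>0. a \<bullet> \<gamma> t < 0 \<and> (\<forall>s\<in>{0..t}. b \<bullet> \<gamma> s > 0)) \<or>
         (\<exists>t\<ge>0. b \<bullet> \<gamma> t < 0 \<and> (\<forall>s\<in>{0..t}. a \<bullet> \<gamma> s > 0))"
proof -
  note mem = sphere_solution_mem[OF sol]
  have cont: "continuous_on B (\<lambda>t. c \<bullet> \<gamma> t)" "continuous_on B (\<lambda>t. dist (\<gamma> t) p)" for B c
    by (intro continuous_intros sphere_solution_continuous[OF sol])+
  define Z where "Z = {s. 0 \<le> a \<bullet> \<gamma> s} \<inter> {s. 0 \<le> b \<bullet> \<gamma> s} \<inter> {s. dist (\<gamma> s) p \<le> r}"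
  have "closed Z"
    unfolding Z_def by (intro closed_Int closed_Collect_le cont continuous_on_const)
  have wedge': "(a \<bullet> \<gamma> s = 0 \<longrightarrow> a \<bullet> X (\<gamma> s) < 0) \<and> (b \<bullet> \<gamma> s = 0 \<longrightarrow> b \<bullet> X (\<gamma> s) < 0) \<and>
      (0 < a \<bullet> \<gamma> s \<longrightarrow> 0 < b \<bullet> \<gamma> s \<longrightarrow> (a + b) \<bullet> X (\<gamma> s) < 0) \<and>
      dist (\<gamma> s) p \<le> K * ((a + b) \<bullet> \<gamma> s)" if "s \<in> Z" for s
    using wedge[OF mem p, of s] that unfolding Z_def by simp
  \<comment> \<open>A face touched strictly before \<open>t\<close> would be crossed at once, its
    coordinate having negative derivative there. So the orbit is in the open wedge, the only place
    where \<open>a + b\<close> is assumed to decrease.\<close>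
  have stay: "0 < c \<bullet> \<gamma> s" if "{0..t} \<subseteq> Z" "0 \<le> s" "s < t" "c = a \<or> c = b" for c s t
  proof (rule ccontr)
    have nonneg: "0 \<le> c \<bullet> \<gamma> x" if "x \<in> {0..t}" for x
      using \<open>{0..t} \<subseteq> Z\<close> that \<open>c = a \<or> c = b\<close> unfolding Z_def by auto
    assume "\<not> 0 < c \<bullet> \<gamma> s"
    then have 0: "c \<bullet> \<gamma> s = 0" using nonneg[of s] that by force
    have "s \<in> Z" using that by auto
    then have "c \<bullet> X (\<gamma> s) < 0" using wedge'[of s] 0 that(4) by auto
    then obtain d where d: "d > 0" "\<And>h. 0 < h \<Longrightarrow> h < d \<Longrightarrow> c \<bullet> \<gamma> (s + h) < c \<bullet> \<gamma> s"
      using DERIV_neg_dec_right[OF sphere_solution_inner[OF sol]] by blast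
    define h where "h = min (d / 2) (t - s)"
    have "0 < h" "h < d" "s + h \<in> {0..t}" using d(1) that by (auto simp: h_def)
    then show False using d(2)[of h] 0 nonneg[of "s + h"] by linarith
  qed
  have dec: "(a + b) \<bullet> \<gamma> t \<le> (a + b) \<bullet> \<gamma> 0 \<and> (t > 0 \<longrightarrow> (a + b) \<bullet> \<gamma> t < (a + b) \<bullet> \<gamma> 0)"
    if "{0..t} \<subseteq> Z" "t \<ge> 0" for t
  proof (cases "t = 0")
    case False
    have "(a + b) \<bullet> \<gamma> t < (a + b) \<bullet> \<gamma> 0"
    proof (rule DERIV_neg_imp_decreasing_open[OF _ _ cont(1)])
      fix x assume x: "0 < x" "x < t"
      then have "x \<in> Z" using that(1) by auto
      then have "(a + b) \<bullet> X (\<gamma> x) < 0"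
        using wedge'[of x] stay[OF that(1), of x a] stay[OF that(1), of x b] x by simp
      then show "\<exists>y. ((\<lambda>t. (a + b) \<bullet> \<gamma> t) has_real_derivative y) (at x) \<and> y < 0"
        using sphere_solution_inner[OF sol] by blast
    qed (use False that in auto)
    then show ?thesis by simp
  qed simp
  \<comment> \<open>The supremum \<open>u\<close> of \<open>G\<close> is the exit time. The orbit is
    still in the closed wedge at time \<open>u\<close>, and not in its interior, since otherwise
    \<open>G\<close> would extend beyond \<open>u\<close>.\<close>
  define G where "G = {t. 0 \<le> t \<and> {0..t} \<subseteq> Z}"
  have G0: "0 \<in> G" using start by (auto simp: G_def Z_def)
  have GT: "t < T" if "t \<in> G" for t
  proof (rule ccontr)
    assume "\<not> t < T"
    then have "{0..T} \<subseteq> Z" using that by (auto simp: G_def)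
    then show False using dec[of T] T by simp
  qed
  have bdd: "bdd_above G" using GT by (intro bdd_aboveI[of _ T]) (simp add: less_imp_le)
  define u where "u = Sup G"
  have u: "0 \<le> u" unfolding u_def by (rule cSup_upper[OF G0 bdd])
  have "s \<in> Z" if "0 \<le> s" "s < u" for s
  proof -
    obtain t where "t \<in> G" "s < t"
      using \<open>s < u\<close> less_cSup_iff[OF _ bdd, of s] G0 unfolding u_def by auto
    then show ?thesis using that by (auto simp: G_def)
  qed
  then have sub: "{0..u} \<subseteq> Z"
  proof (cases "u = 0")
    case False
    have "closure {0..<u} \<subseteq> Z"
      by (rule closure_minimal) (use \<open>\<And>s. 0 \<le> s \<Longrightarrow> s < u \<Longrightarrow> s \<in> Z\<close> \<open>closed Z\<close> in auto)
    then show ?thesis using False u by simp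
  qed (use G0 in \<open>simp add: G_def\<close>)
  then have uZ: "u \<in> Z" using u by auto
  have nonneg: "0 \<le> a \<bullet> \<gamma> u" "0 \<le> b \<bullet> \<gamma> u" using uZ by (auto simp: Z_def)
  have "dist (\<gamma> u) p \<le> K * ((a + b) \<bullet> \<gamma> u)" using wedge'[OF uZ] by simp
  also have "\<dots> \<le> K * ((a + b) \<bullet> \<gamma> 0)" using dec[OF sub u] \<open>K \<ge> 0\<close> by (simp add: mult_left_mono)
  finally have lt: "dist (\<gamma> u) p < r" using start(4) by simp
  have pos: "(a + b) \<bullet> \<gamma> u \<noteq> 0"
    using wedge'[OF uZ] p[of u] by auto
  consider "0 < a \<bullet> \<gamma> u" "0 < b \<bullet> \<gamma> u" | "a \<bullet> \<gamma> u = 0" "0 < b \<bullet> \<gamma> u" | "b \<bullet> \<gamma> u = 0" "0 < a \<bullet> \<gamma> u"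
    using nonneg pos by (force simp: inner_add_left)
  then show ?thesis
  proof cases
    case 1
    define W where "W = {s. 0 < a \<bullet> \<gamma> s} \<inter> {s. 0 < b \<bullet> \<gamma> s} \<inter> {s. dist (\<gamma> s) p < r}"
    have "open W" "u \<in> W"
      unfolding W_def using 1 lt by (auto intro!: open_Int open_Collect_less cont continuous_on_const)
    then obtain e where e: "e > 0" "\<And>s. dist s u < e \<Longrightarrow> s \<in> W" by (auto simp: open_dist)
    have "s \<in> Z" if "s \<in> {0..u + e / 2}" for s
    proof (cases "s \<le> u")
      case False
      then have "s \<in> W" using that e(1) by (intro e(2)) (auto simp: dist_real_def)
      then show ?thesis by (auto simp: W_def Z_def)
    qed (use sub that in auto)
    then have "u + e / 2 \<in> G" using u e(1) by (auto simp: G_def)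
    then show ?thesis using cSup_upper[OF _ bdd, of "u + e / 2"] e(1) by (simp add: u_def)
  next
    case 2
    then have "a \<bullet> X (\<gamma> u) < 0" using wedge'[OF uZ] by simp
    then show ?thesis
      using immediate_exit[OF sphere_solution_inner[OF sol] _ 2(1) cont(1) 2(2) _ u] stay[OF sub, of _ b] by auto
  next
    case 3
    then have "b \<bullet> X (\<gamma> u) < 0" using wedge'[OF uZ] by simp
    then show ?thesis
      using immediate_exit[OF sphere_solution_inner[OF sol] _ 3(1) cont(1) 3(2) _ u] stay[OF sub, of _ a] by auto
  qed
qed

text \<open>Wazewski's retract argument: on an arc joining the two sides of the wedge, the sets of points
  leaving it through one side or the other are open, disjoint and nonempty, so some point never
  leaves; its orbit would have to be strictly monotone.\<close>

lemma wedge_not_center: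
  assumes X: "L-lipschitz_on unit_sphere X"
    and ab: "a \<bullet> p = 0" "b \<bullet> p = 0" "a \<bullet> v = 0" "b \<bullet> v = 1" "a \<bullet> w = 1" "b \<bullet> w = 0"
    and wedge: "\<And>q. q \<in> unit_sphere \<Longrightarrow> q \<noteq> p \<Longrightarrow> dist q p \<le> r \<Longrightarrow> 0 \<le> a \<bullet> q \<Longrightarrow> 0 \<le> b \<bullet> q \<Longrightarrow>
        (a \<bullet> q = 0 \<longrightarrow> a \<bullet> X q < 0) \<and> (b \<bullet> q = 0 \<longrightarrow> b \<bullet> X q < 0) \<and>
        (0 < a \<bullet> q \<longrightarrow> 0 < b \<bullet> q \<longrightarrow> (a + b) \<bullet> X q < 0) \<and> dist q p \<le> K * ((a + b) \<bullet> q)"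
    and "r > 0" "K \<ge> 0"
  shows "\<not> sphere_center X p"
proof
  assume "sphere_center X p"
  then obtain \<rho> where p: "p \<in> unit_sphere" and \<rho>: "\<rho> > 0"
    "\<And>q. q \<in> unit_sphere \<Longrightarrow> q \<noteq> p \<Longrightarrow> dist q p < \<rho> \<Longrightarrow> periodic_through X p q"
    unfolding sphere_center_iff sphere_singularity_def by blast
  have L: "L \<ge> 0" using X lipschitz_on_def by blast
  \<comment> \<open>The last bound secures the starting condition of \<open>wedge_exit\<close>, that
    \<open>K\<close> times \<open>a + b\<close> is below \<open>r\<close>; the summand 1 keeps the
    denominator positive.\<close>
  define \<eta> where "\<eta> = min \<rho> (min r (r / (K * norm (a + b) + 1)))"
  have den: "K * norm (a + b) + 1 > 0" using \<open>K \<ge> 0\<close> by (simp add: add_nonneg_pos)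
  have \<eta>: "\<eta> > 0" using \<rho>(1) \<open>r > 0\<close> den by (simp add: \<eta>_def)
  define N where "N = norm v + norm w + 1"
  define \<epsilon> where "\<epsilon> = \<eta> / (4 * N)"
  have N: "N > 0" by (simp add: N_def add_nonneg_pos)
  have \<epsilon>: "\<epsilon> > 0" using \<eta> N by (simp add: \<epsilon>_def)
  \<comment> \<open>As \<open>v\<close>, \<open>w\<close> are dual to \<open>a\<close>,
    \<open>b\<close>, this segment runs from the face where \<open>a\<close> vanishes to the face
    where \<open>b\<close> vanishes. Radial projection to the sphere only multiplies both
    coordinates by a positive factor.\<close>
  define f where "f s = p + \<epsilon> *\<^sub>R ((1 - s) *\<^sub>R v + s *\<^sub>R w)" for s :: real
  define \<sigma> where "\<sigma> s = (1 / norm (f s)) *\<^sub>R f s" for s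
  have af: "a \<bullet> f s = \<epsilon> * s" "b \<bullet> f s = \<epsilon> * (1 - s)" for s
    using ab by (simp_all add: f_def inner_add_right)
  have f0: "f s \<noteq> 0" for s
  proof
    assume "f s = 0"
    then show False using af[of s] \<epsilon> by simp
  qed
  have \<sigma>_sphere: "\<sigma> s \<in> unit_sphere" for s using f0 by (simp add: \<sigma>_def)
  have \<sigma>_cont: "continuous_on {0..1} \<sigma>"
    unfolding \<sigma>_def f_def by (intro continuous_intros) (use f0 in \<open>auto simp: f_def\<close>)
  have a\<sigma>: "a \<bullet> \<sigma> s = \<epsilon> * s / norm (f s)" "b \<bullet> \<sigma> s = \<epsilon> * (1 - s) / norm (f s)" for s
    using af by (simp_all add: \<sigma>_def)
  have \<sigma>_p: "\<sigma> s \<noteq> p" for s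
  proof
    assume "\<sigma> s = p"
    then have "\<epsilon> * s = 0" "\<epsilon> * (1 - s) = 0" using a\<sigma>[of s] ab f0[of s] by auto
    then show False using \<epsilon> by simp
  qed
  have \<sigma>_dist: "dist (\<sigma> s) p < \<eta>" if "s \<in> {0..1}" for s
  proof -
    have "norm ((1 - s) *\<^sub>R v + s *\<^sub>R w) \<le> norm v + norm w"
      using that by (intro norm_triangle_le add_mono) (auto simp: mult_left_le_one_le)
    then have fp: "norm (f s - p) \<le> \<epsilon> * N"
      using \<epsilon> by (simp add: f_def N_def)
    have "\<sigma> s - f s = (1 / norm (f s) - 1) *\<^sub>R f s" by (simp add: \<sigma>_def scaleR_diff_left)
    then have "norm (\<sigma> s - f s) = \<bar>(1 / norm (f s) - 1) * norm (f s)\<bar>"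
      by (simp add: abs_mult)
    also have "(1 / norm (f s) - 1) * norm (f s) = norm p - norm (f s)"
      using f0 p by (simp add: field_simps)
    also have "\<bar>norm p - norm (f s)\<bar> \<le> norm (f s - p)" by (metis norm_minus_commute norm_triangle_ineq3)
    finally have "dist (\<sigma> s) p \<le> 2 * norm (f s - p)"
      using norm_triangle_ineq[of "\<sigma> s - f s" "f s - p"] by (simp add: dist_norm)
    also have "\<dots> \<le> 2 * (\<epsilon> * N)" using fp by simp
    also have "\<dots> < \<eta>" using \<eta> N by (simp add: \<epsilon>_def)
    finally show ?thesis .
  qed
  have "\<exists>\<gamma>. \<exists>T>0. sphere_solution X \<gamma> \<and> \<gamma> 0 = \<sigma> s \<and> \<gamma> T = \<gamma> 0 \<and> (\<forall>t. \<gamma> t \<noteq> p)"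
    if "s \<in> {0..1}" for s
  proof -
    have "periodic_through X p (\<sigma> s)"
      using \<rho>(2)[OF \<sigma>_sphere \<sigma>_p] \<sigma>_dist[OF that] by (simp add: \<eta>_def)
    then show ?thesis unfolding periodic_through_def by (metis add_0)
  qed
  then obtain \<gamma> where ex: "\<And>s. s \<in> {0..1} \<Longrightarrow>
      \<exists>T>0. sphere_solution X (\<gamma> s) \<and> \<gamma> s 0 = \<sigma> s \<and> \<gamma> s T = \<gamma> s 0 \<and> (\<forall>t. \<gamma> s t \<noteq> p)"
    by metis
  then have \<gamma>: "sphere_solution X (\<gamma> s)" "\<gamma> s 0 = \<sigma> s" if "s \<in> {0..1}" for s using that by blast+
  \<comment> \<open>Keeping the other coordinate strictly positive up to the exit makes the two sets
    disjoint, and all conditions are strict on a compact time interval, which makes them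
    open.\<close>
  define E where "E a b = {s \<in> {0..1}. \<exists>t\<ge>0. a \<bullet> \<gamma> s t < 0 \<and> (\<forall>\<tau>\<in>{0..t}. b \<bullet> \<gamma> s \<tau> > 0)}" for a b
  have E_open: "openin (top_of_set {0..1}) (E a b)" for a b
    unfolding openin_euclidean_subtopology_iff
  proof (intro conjI ballI)
    fix s assume "s \<in> E a b"
    then obtain t where s: "s \<in> {0..1}" and t: "t \<ge> 0" "a \<bullet> \<gamma> s t < 0" "\<And>\<tau>. \<tau> \<in> {0..t} \<Longrightarrow> b \<bullet> \<gamma> s \<tau> > 0"
      unfolding E_def by blast
    have "continuous_on {0..t} (\<lambda>\<tau>. b \<bullet> \<gamma> s \<tau>)"
      by (intro continuous_intros sphere_solution_continuous[OF \<gamma>(1)[OF s]])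
    then obtain \<tau>0 where \<tau>0: "\<tau>0 \<in> {0..t}" "\<And>\<tau>. \<tau> \<in> {0..t} \<Longrightarrow> b \<bullet> \<gamma> s \<tau>0 \<le> b \<bullet> \<gamma> s \<tau>"
      using continuous_attains_inf[of "{0..t}" "\<lambda>\<tau>. b \<bullet> \<gamma> s \<tau>"] t(1) by auto
    \<comment> \<open>The strict inequalities survive perturbations below the margin
      \<open>\<mu>\<close>; by Gronwall, \<open>C\<close> bounds the perturbation on
      \<open>{0..t}\<close> in terms of the distance of the initial points.\<close>
    define \<mu> where "\<mu> = min (b \<bullet> \<gamma> s \<tau>0) (- (a \<bullet> \<gamma> s t))"
    define C where "C = exp (L * t) * (norm a + norm b + 1)"
    have \<mu>: "\<mu> > 0" using t \<tau>0(1) by (simp add: \<mu>_def)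
    have C: "C > 0" by (simp add: C_def add_nonneg_pos)
    obtain d where d: "d > 0" "\<And>s'. s' \<in> {0..1} \<Longrightarrow> dist s' s < d \<Longrightarrow> dist (\<sigma> s') (\<sigma> s) < \<mu> / C"
      using \<sigma>_cont[unfolded continuous_on_iff, rule_format, OF s divide_pos_pos[OF \<mu> C]] by blast
    have "s' \<in> E a b" if s': "s' \<in> {0..1}" "dist s' s < d" for s'
    proof -
      have near: "\<bar>c \<bullet> \<gamma> s' \<tau> - c \<bullet> \<gamma> s \<tau>\<bar> < \<mu>" if "\<tau> \<in> {0..t}" "c = a \<or> c = b" for c \<tau>
      proof -
        have "\<bar>c \<bullet> \<gamma> s' \<tau> - c \<bullet> \<gamma> s \<tau>\<bar> \<le> norm c * dist (\<gamma> s' \<tau>) (\<gamma> s \<tau>)"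
          unfolding dist_norm inner_diff_right[symmetric] by (rule Cauchy_Schwarz_ineq2)
        also have "\<dots> \<le> (norm a + norm b + 1) * (exp (L * t) * dist (\<sigma> s') (\<sigma> s))"
        proof (intro mult_mono)
          have "dist (\<gamma> s' \<tau>) (\<gamma> s \<tau>) \<le> exp (L * \<tau>) * dist (\<gamma> s' 0) (\<gamma> s 0)"
            by (rule sphere_solution_growth[OF X \<gamma>(1) \<gamma>(1)]) (use s s' that in auto)
          also have "\<dots> \<le> exp (L * t) * dist (\<sigma> s') (\<sigma> s)"
            using that(1) L s s'(1) \<gamma>(2) by (intro mult_mono) (auto simp: mult_left_mono)
          finally show "dist (\<gamma> s' \<tau>) (\<gamma> s \<tau>) \<le> exp (L * t) * dist (\<sigma> s') (\<sigma> s)" .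
        qed (use that in \<open>auto simp: add_nonneg_nonneg\<close>)
        also have "\<dots> = C * dist (\<sigma> s') (\<sigma> s)" by (simp add: C_def)
        also have "\<dots> < \<mu>" using d(2)[OF s'] C by (simp add: field_simps)
        finally show ?thesis .
      qed
      have \<mu>_le: "\<mu> \<le> b \<bullet> \<gamma> s \<tau>0" "\<mu> \<le> - (a \<bullet> \<gamma> s t)" by (auto simp: \<mu>_def)
      have "a \<bullet> \<gamma> s' t < 0" using near[of t a] t(1) \<mu>_le by auto
      moreover have "b \<bullet> \<gamma> s' \<tau> > 0" if "\<tau> \<in> {0..t}" for \<tau>
        using near[OF that, of b] \<tau>0(2)[OF that] \<mu>_le by auto
      ultimately show ?thesis using s'(1) t(1) by (auto simp: E_def)
    qed
    then show "\<exists>e>0. \<forall>x'\<in>{0..1}. dist x' s < e \<longrightarrow> x' \<in> E a b" using d(1) by blast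
  qed (auto simp: E_def)
  have cover: "s \<in> E a b \<union> E b a" if s: "s \<in> {0..1}" for s
  proof -
    obtain T where T: "T > 0" "\<gamma> s T = \<gamma> s 0" "\<And>t. \<gamma> s t \<noteq> p" using ex[OF s] by blast
    have "(a + b) \<bullet> \<sigma> s = (a + b) \<bullet> (\<sigma> s - p)" using ab by (simp add: inner_diff_right inner_add_left)
    also have "\<dots> \<le> norm (a + b) * dist (\<sigma> s) p" unfolding dist_norm by (rule norm_cauchy_schwarz)
    finally have "K * ((a + b) \<bullet> \<sigma> s) \<le> K * (norm (a + b) * dist (\<sigma> s) p)"
      using \<open>K \<ge> 0\<close> by (rule mult_left_mono)
    also have "\<dots> \<le> (K * norm (a + b) + 1) * dist (\<sigma> s) p" by (simp add: algebra_simps)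
    also have "\<dots> < r"
      using \<sigma>_dist[OF s] den by (simp add: \<eta>_def field_simps)
    finally have "K * ((a + b) \<bullet> \<sigma> s) < r" .
    then show ?thesis
      using wedge_exit[OF \<gamma>(1)[OF s] T wedge _ _ _ _ \<open>K \<ge> 0\<close>] s \<sigma>_dist[OF s] a\<sigma>[of s] \<gamma>(2)[OF s] \<epsilon>
      by (auto simp: E_def \<eta>_def)
  qed
  have disj: "E a b \<inter> E b a = {}"
  proof -
    have False if "s \<in> E a b" "s \<in> E b a" for s
    proof -
      obtain t t' where "t \<ge> 0" "a \<bullet> \<gamma> s t < 0" "\<And>\<tau>. \<tau> \<in> {0..t} \<Longrightarrow> b \<bullet> \<gamma> s \<tau> > 0"
        and "t' \<ge> 0" "b \<bullet> \<gamma> s t' < 0" "\<And>\<tau>. \<tau> \<in> {0..t'} \<Longrightarrow> a \<bullet> \<gamma> s \<tau> > 0"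
        using \<open>s \<in> E a b\<close> \<open>s \<in> E b a\<close> unfolding E_def by blast
      then have "\<not> t \<le> t'" "\<not> t' \<le> t" by (meson atLeastAtMost_iff not_less_iff_gr_or_eq)+
      then show False by simp
    qed
    then show ?thesis by blast
  qed
  \<comment> \<open>Each end of the arc starts on a face, which violates strict positivity at time 0
    for one of the two sets; the covering puts it into the other.\<close>
  have "a \<bullet> \<gamma> 0 0 = 0" "b \<bullet> \<gamma> 1 0 = 0" using a\<sigma> \<gamma>(2) by simp_all
  then have "0 \<notin> E b a" "1 \<notin> E a b" unfolding E_def by force+
  then have "0 \<in> E a b" "1 \<in> E b a" using cover[of 0] cover[of 1] by auto
  then have ne: "E a b \<noteq> {}" "E b a \<noteq> {}" by blast+
  have "{0..1} \<subseteq> E a b \<union> E b a" using cover by blast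
  then show False
    using connected_Icc[of 0 "1::real"] E_open[of a b] E_open[of b a] disj ne
    unfolding connected_openin by blast
qed

section \<open>Quadratic fields\<close>

lemma quadratic_field_component [simp]:
  "quadratic_field a1 a2 a4 a5 a7 a8 v $ 1 =
     a1 * v $ 1 * v $ 2 + a2 * (v $ 2)\<^sup>2 + a4 * v $ 1 * v $ 3 + a5 * v $ 2 * v $ 3"
  "quadratic_field a1 a2 a4 a5 a7 a8 v $ 2 =
     - a1 * (v $ 1)\<^sup>2 - a2 * v $ 1 * v $ 2 + a7 * v $ 1 * v $ 3 + a8 * v $ 2 * v $ 3"
  "quadratic_field a1 a2 a4 a5 a7 a8 v $ 3 =
     - a4 * (v $ 1)\<^sup>2 - a8 * (v $ 2)\<^sup>2 - (a5 + a7) * v $ 1 * v $ 2"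
  by (simp_all add: quadratic_field_def Let_def)

lemma inner_quadratic_field: "v \<bullet> quadratic_field a1 a2 a4 a5 a7 a8 v = 0"
  by (simp add: inner_vec_def sum_3 algebra_simps power2_eq_square)

lemma quadratic_field_uminus:
  "quadratic_field (-a1) (-a2) (-a4) (-a5) (-a7) (-a8) = (\<lambda>v. - quadratic_field a1 a2 a4 a5 a7 a8 v)"
  by (rule ext) (simp add: vec_eq_iff forall_3 algebra_simps)

lemma vec3_eq_iff: "v = w \<longleftrightarrow> v $ 1 = w $ 1 \<and> v $ 2 = w $ 2 \<and> v $ 3 = w $ 3" for v w :: "real ^ 3"
  by (simp add: vec_eq_iff forall_3)

lemma inner_vec3: "v \<bullet> w = v $ 1 * w $ 1 + v $ 2 * w $ 2 + v $ 3 * w $ 3" for v w :: "real ^ 3"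
  by (simp add: inner_vec_def sum_3)

lemma unit_sphere_iff: "v \<in> unit_sphere \<longleftrightarrow> (v $ 1)\<^sup>2 + (v $ 2)\<^sup>2 + (v $ 3)\<^sup>2 = 1"
  by (simp add: norm_eq_sqrt_inner inner_vec3 power2_eq_square)

text \<open>On the unit ball a product of two coordinates changes by at most twice the distance, so
  each of the three components contributes \<open>2 * C\<close>. The ball, being convex, admits the
  projection that later extends the bound to the whole space.\<close>

lemma quadratic_field_lipschitz:
  obtains L where "L-lipschitz_on (cball 0 1) (quadratic_field a1 a2 a4 a5 a7 a8)"
proof -
  define C where "C = \<bar>a1\<bar> + \<bar>a2\<bar> + \<bar>a4\<bar> + \<bar>a5\<bar> + \<bar>a7\<bar> + \<bar>a8\<bar>"
  have "(6 * C)-lipschitz_on (cball 0 1) (quadratic_field a1 a2 a4 a5 a7 a8)" (is "_-lipschitz_on _ ?X")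
  proof (rule lipschitz_onI)
    fix v w :: "real ^ 3" assume vw: "v \<in> cball 0 1" "w \<in> cball 0 1"
    define e where "e = dist v w"
    define m where "m i j = v $ i * v $ j - w $ i * w $ j" for i j
    have m: "\<bar>m i j\<bar> \<le> 2 * e" for i j
    proof -
      have v1: "\<bar>v $ i\<bar> \<le> 1" using component_le_norm_cart[of v i] vw by simp
      have w1: "\<bar>w $ j\<bar> \<le> 1" using component_le_norm_cart[of w j] vw by simp
      have d: "\<bar>v $ k - w $ k\<bar> \<le> e" for k
        using component_le_norm_cart[of "v - w" k] by (simp add: e_def dist_norm)
      have "m i j = v $ i * (v $ j - w $ j) + (v $ i - w $ i) * w $ j"
        by (simp add: m_def algebra_simps)
      also have "\<bar>\<dots>\<bar> \<le> \<bar>v $ i\<bar> * \<bar>v $ j - w $ j\<bar> + \<bar>v $ i - w $ i\<bar> * \<bar>w $ j\<bar>"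
        unfolding abs_mult[symmetric] by (rule abs_triangle_ineq)
      also have "\<dots> \<le> 1 * e + e * 1"
        using v1 w1 d by (intro add_mono mult_mono) (auto simp: e_def)
      finally show ?thesis by simp
    qed
    define B where "B x = \<bar>x\<bar> * (2 * e)" for x
    have B: "x * m i j \<le> B x" "- (x * m i j) \<le> B x" "0 \<le> B x" for x i j
    proof -
      have "\<bar>x * m i j\<bar> \<le> B x" using m by (simp add: B_def abs_mult mult_left_mono)
      then show "x * m i j \<le> B x" "- (x * m i j) \<le> B x" by (simp_all add: abs_le_iff)
    qed (simp add: B_def e_def)
    have comp: "\<bar>(?X v - ?X w) $ i\<bar> \<le> C * (2 * e)" for i
    proof -
      have "(?X v - ?X w) $ 1 = a1 * m 1 2 + a2 * m 2 2 + a4 * m 1 3 + a5 * m 2 3"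
        "(?X v - ?X w) $ 2 = - (a1 * m 1 1) - a2 * m 1 2 + a7 * m 1 3 + a8 * m 2 3"
        "(?X v - ?X w) $ 3 = - (a4 * m 1 1) - a8 * m 2 2 - a5 * m 1 2 - a7 * m 1 2"
        by (simp_all add: m_def power2_eq_square algebra_simps)
      moreover have "C * (2 * e) = B a1 + B a2 + B a4 + B a5 + B a7 + B a8"
        by (simp add: B_def C_def algebra_simps)
      moreover note B(1,2)[of a1 1 1] B(1,2)[of a1 1 2] B(1,2)[of a2 1 2] B(1,2)[of a2 2 2] B(1,2)[of a4 1 1]
        B(1,2)[of a4 1 3] B(1,2)[of a5 1 2] B(1,2)[of a5 2 3] B(1,2)[of a7 1 2] B(1,2)[of a7 1 3]
        B(1,2)[of a8 2 2] B(1,2)[of a8 2 3] B(3)[of a1] B(3)[of a2] B(3)[of a4] B(3)[of a5] B(3)[of a7] B(3)[of a8]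
      ultimately have "\<bar>(?X v - ?X w) $ 1\<bar> \<le> C * (2 * e)" "\<bar>(?X v - ?X w) $ 2\<bar> \<le> C * (2 * e)"
        "\<bar>(?X v - ?X w) $ 3\<bar> \<le> C * (2 * e)"
        unfolding abs_le_iff by linarith+
      then show ?thesis using exhaust_3[of i] by blast
    qed
    have "dist (?X v) (?X w) \<le> (\<Sum>i\<in>UNIV. \<bar>(?X v - ?X w) $ i\<bar>)"
      unfolding dist_norm by (rule norm_le_l1_cart)
    also have "\<dots> \<le> 6 * C * e" unfolding sum_3 by (rule order_trans[OF add_mono[OF add_mono[OF comp comp] comp]]) simp
    finally show "dist (?X v) (?X w) \<le> 6 * C * dist v w" by (simp add: e_def)
  qed (simp add: C_def)
  then show ?thesis by (rule that)
qed

text \<open>The projection does not change directions, so a field orthogonal to the position vector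
  remains so after composition with it.\<close>

lemma closest_point_unit_cball:
  fixes v :: "'a::euclidean_space"
  shows "\<exists>k>0. closest_point (cball 0 1) v = k *\<^sub>R v"
proof (cases "norm v \<le> 1")
  case True
  then show ?thesis by (intro exI[of _ 1]) (simp add: closest_point_self)
next
  case False
  have v: "v \<noteq> 0" "norm v > 1" using False by auto
  have "(1 / norm v) *\<^sub>R v = closest_point (cball 0 1) v"
  proof (rule closest_point_unique)
    show "\<forall>z\<in>cball 0 1. dist v ((1 / norm v) *\<^sub>R v) \<le> dist v z"
    proof
      fix z :: 'a assume "z \<in> cball 0 1"
      have "v - (1 / norm v) *\<^sub>R v = (1 - 1 / norm v) *\<^sub>R v" by (simp add: scaleR_diff_left)
      then have "dist v ((1 / norm v) *\<^sub>R v) = (1 - 1 / norm v) * norm v"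
        using v by (simp only: dist_norm norm_scaleR) (simp add: divide_le_eq)
      also have "\<dots> = norm v - 1" using v by (simp add: field_simps)
      also have "\<dots> \<le> norm v - norm z" using \<open>z \<in> cball 0 1\<close> by simp
      also have "\<dots> \<le> dist v z" unfolding dist_norm by (rule norm_triangle_ineq2)
      finally show "dist v ((1 / norm v) *\<^sub>R v) \<le> dist v z" .
    qed
  qed (use False in auto)
  then show ?thesis using v by (intro exI[of _ "1 / norm v"]) simp
qed

text \<open>The field is tangent to every concentric sphere, so even the truncated, globally
  Lipschitz field \<open>?X \<circ> \<pi>\<close> conserves the norm. Starting on the unit sphere,
  the truncation therefore never takes effect.\<close>

lemma quadratic_field_solution:
  assumes "q \<in> unit_sphere"
  obtains \<gamma> where "sphere_solution (quadratic_field a1 a2 a4 a5 a7 a8) \<gamma>" "\<gamma> 0 = q"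
proof -
  let ?X = "quadratic_field a1 a2 a4 a5 a7 a8"
  define \<pi> :: "real ^ 3 \<Rightarrow> real ^ 3" where "\<pi> = closest_point (cball 0 1)"
  obtain L where L: "L-lipschitz_on (cball 0 1) ?X" by (rule quadratic_field_lipschitz)
  have "1-lipschitz_on UNIV \<pi>"
    by (rule lipschitz_onI) (simp_all add: \<pi>_def closest_point_lipschitz)
  moreover have "\<pi> ` UNIV \<subseteq> cball 0 1"
    unfolding \<pi>_def using closest_point_in_set[of "cball (0 :: real ^ 3) 1"] by force
  ultimately have "(L * 1)-lipschitz_on UNIV (?X \<circ> \<pi>)"
    by (intro lipschitz_on_compose lipschitz_on_subset[OF L])
  then obtain \<gamma> where \<gamma>: "\<gamma> 0 = q" "\<And>t. (\<gamma> has_vector_derivative ?X (\<pi> (\<gamma> t))) (at t)"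
    using lipschitz_global_solution[of _ "?X \<circ> \<pi>" q] by (metis comp_apply)
  have orth: "\<gamma> t \<bullet> ?X (\<pi> (\<gamma> t)) = 0" for t
  proof -
    obtain k where k: "k > 0" "\<pi> (\<gamma> t) = k *\<^sub>R \<gamma> t"
      unfolding \<pi>_def using closest_point_unit_cball by blast
    then show ?thesis using inner_quadratic_field[of "\<pi> (\<gamma> t)"] by simp
  qed
  have const: "((\<lambda>t. \<gamma> t \<bullet> \<gamma> t) has_real_derivative 0) (at t)" for t
  proof -
    have "((\<lambda>s. \<gamma> s \<bullet> \<gamma> s) has_derivative (\<lambda>h. \<gamma> t \<bullet> (h *\<^sub>R ?X (\<pi> (\<gamma> t))) + (h *\<^sub>R ?X (\<pi> (\<gamma> t))) \<bullet> \<gamma> t)) (at t)"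
      by (rule has_derivative_inner) (use \<gamma>(2)[of t] in \<open>simp_all add: has_vector_derivative_def\<close>)
    then show ?thesis
      unfolding has_field_derivative_def
      by (rule has_derivative_eq_rhs) (simp add: fun_eq_iff inner_commute[of _ "\<gamma> t"] orth)
  qed
  have "\<gamma> t \<bullet> \<gamma> t = \<gamma> 0 \<bullet> \<gamma> 0" for t
    using DERIV_isconst_all[where f = "\<lambda>t. \<gamma> t \<bullet> \<gamma> t" and x = t and y = 0, OF allI[OF const]] .
  then have mem: "\<gamma> t \<in> unit_sphere" for t
    using assms \<gamma>(1) by (simp add: norm_eq_sqrt_inner)
  then have "\<pi> (\<gamma> t) = \<gamma> t" for t unfolding \<pi>_def by (intro closest_point_self) simp
  then have "sphere_solution ?X \<gamma>" using \<gamma>(2) mem by (simp add: sphere_solution_def)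
  then show ?thesis using \<gamma>(1) by (rule that)
qed

abbreviation south_pole :: "real ^ 3" where
  "south_pole \<equiv> vector [0, 0, -1]"

lemma quadratic_field_sphere_lipschitz:
  obtains L where "L-lipschitz_on unit_sphere (quadratic_field a1 a2 a4 a5 a7 a8)"
proof -
  obtain L where "L-lipschitz_on (cball 0 1) (quadratic_field a1 a2 a4 a5 a7 a8)"
    by (rule quadratic_field_lipschitz)
  then show ?thesis by (intro that[of L] lipschitz_on_subset[OF _ sphere_cball])
qed

lemma sphere_singularity_south_pole:
  "sphere_singularity (quadratic_field a1 a2 a4 a5 a7 a8) south_pole"
  by (simp add: sphere_singularity_def norm_eq_sqrt_inner inner_vec3 vec3_eq_iff)

lemma sphere_center_uminus_quadratic_field:
  assumes "sphere_center (quadratic_field a1 a2 a4 a5 a7 a8) p"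
  shows "sphere_center (quadratic_field (-a1) (-a2) (-a4) (-a5) (-a7) (-a8)) p"
  unfolding quadratic_field_uminus by (rule sphere_center_uminus[OF assms])

section \<open>Equivariance under rotations about the z-axis\<close>

definition rotate_z :: "real \<Rightarrow> real \<Rightarrow> real ^ 3 \<Rightarrow> real ^ 3" where
  "rotate_z c s v = vector [c * v $ 1 + s * v $ 2, - s * v $ 1 + c * v $ 2, v $ 3]"

lemma rotate_z_component [simp]:
  "rotate_z c s v $ 1 = c * v $ 1 + s * v $ 2"
  "rotate_z c s v $ 2 = - s * v $ 1 + c * v $ 2"
  "rotate_z c s v $ 3 = v $ 3"
  by (simp_all add: rotate_z_def)

lemma bounded_linear_rotate_z: "bounded_linear (rotate_z c s)"
  by (intro linear_conv_bounded_linear[THEN iffD1] linearI) (simp_all add: vec3_eq_iff algebra_simps)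

lemma rotate_z_inverse:
  assumes "c\<^sup>2 + s\<^sup>2 = 1"
  shows "rotate_z c (- s) (rotate_z c s v) = v"
proof -
  have *: "(c * c + s * s) * x = x" for x using assms by (simp add: power2_eq_square)
  show ?thesis using *[of "v $ 1"] *[of "v $ 2"] by (simp add: vec3_eq_iff algebra_simps)
qed

lemma norm_rotate_z:
  assumes "c\<^sup>2 + s\<^sup>2 = 1"
  shows "norm (rotate_z c s v) = norm v"
proof -
  have "rotate_z c s v \<bullet> rotate_z c s v = (c\<^sup>2 + s\<^sup>2) * ((v $ 1)\<^sup>2 + (v $ 2)\<^sup>2) + (v $ 3)\<^sup>2"
    by (simp add: inner_vec3 power2_eq_square algebra_simps)
  also have "\<dots> = v \<bullet> v" using assms by (simp add: inner_vec3 power2_eq_square)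
  finally show ?thesis by (simp add: norm_eq_sqrt_inner)
qed

text \<open>For the rotation matrix \<open>R\<close> with rows \<open>(c, s)\<close> and
  \<open>(-s, c)\<close>, the new coefficients are those of \<open>R l\<close> and of
  \<open>R A\<close> times the transpose of \<open>R\<close>.\<close>

lemma sphere_center_rotate:
  assumes cs: "c\<^sup>2 + s\<^sup>2 = 1"
  shows "sphere_center (quadratic_field a1 a2 a4 a5 a7 a8) south_pole \<longleftrightarrow>
    sphere_center (quadratic_field (c * a1 + s * a2) (c * a2 - s * a1)
      (c\<^sup>2 * a4 + c * s * (a5 + a7) + s\<^sup>2 * a8) (c\<^sup>2 * a5 - s\<^sup>2 * a7 + c * s * (a8 - a4))
      (c\<^sup>2 * a7 - s\<^sup>2 * a5 + c * s * (a8 - a4)) (s\<^sup>2 * a4 - c * s * (a5 + a7) + c\<^sup>2 * a8)) south_pole"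
    (is "sphere_center ?X _ \<longleftrightarrow> sphere_center ?Y _")
proof -
  have conj: "?Y (rotate_z c s v) = rotate_z c s (?X v)" for v
  proof -
    define x y z where "x = v $ 1" and "y = v $ 2" and "z = v $ 3"
    define x' y' where "x' = c * x + s * y" and "y' = - s * x + c * y"
    define A B where "A = a4 * x + a5 * y" and "B = a7 * x + a8 * y"
    define a4' a5' a7' a8' where "a4' = c\<^sup>2 * a4 + c * s * (a5 + a7) + s\<^sup>2 * a8"
      and "a5' = c\<^sup>2 * a5 - s\<^sup>2 * a7 + c * s * (a8 - a4)"
      and "a7' = c\<^sup>2 * a7 - s\<^sup>2 * a5 + c * s * (a8 - a4)"
      and "a8' = s\<^sup>2 * a4 - c * s * (a5 + a7) + c\<^sup>2 * a8"
    have "(c * a1 + s * a2) * x' + (c * a2 - s * a1) * y' = (c\<^sup>2 + s\<^sup>2) * (a1 * x + a2 * y)"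
      by (simp add: x'_def y'_def power2_eq_square algebra_simps)
    then have l: "(c * a1 + s * a2) * x' + (c * a2 - s * a1) * y' = a1 * x + a2 * y" using cs by simp
    have "a4' * x' + a5' * y' = (c\<^sup>2 + s\<^sup>2) * (c * A + s * B)"
      "a7' * x' + a8' * y' = (c\<^sup>2 + s\<^sup>2) * (- s * A + c * B)"
      by (simp_all add: x'_def y'_def A_def B_def a4'_def a5'_def a7'_def a8'_def power2_eq_square algebra_simps)
    then have AB: "a4' * x' + a5' * y' = c * A + s * B" "a7' * x' + a8' * y' = - s * A + c * B"
      using cs by simp_all
    have "x' * (c * A + s * B) + y' * (- s * A + c * B) = (c\<^sup>2 + s\<^sup>2) * (x * A + y * B)"
      by (simp add: x'_def y'_def power2_eq_square algebra_simps)
    then have 3: "x' * (c * A + s * B) + y' * (- s * A + c * B) = x * A + y * B" using cs by simp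
    \<comment> \<open>Written this way, the field involves only \<open>l\<close>, \<open>A w\<close>
      and \<open>w \<bullet> A w\<close>, and equivariance reduces to the three identities above,
      each a consequence of orthogonality.\<close>
    have field: "quadratic_field b1 b2 b4 b5 b7 b8 u = vector
        [u $ 2 * (b1 * u $ 1 + b2 * u $ 2) + u $ 3 * (b4 * u $ 1 + b5 * u $ 2),
         - u $ 1 * (b1 * u $ 1 + b2 * u $ 2) + u $ 3 * (b7 * u $ 1 + b8 * u $ 2),
         - (u $ 1 * (b4 * u $ 1 + b5 * u $ 2) + u $ 2 * (b7 * u $ 1 + b8 * u $ 2))]"
      for b1 b2 b4 b5 b7 b8 u
      by (simp add: vec3_eq_iff power2_eq_square algebra_simps)
    have "rotate_z c s v = vector [x', y', z]"
      by (simp add: vec3_eq_iff x'_def y'_def x_def y_def z_def)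
    then show ?thesis
      unfolding field a4'_def[symmetric] a5'_def[symmetric] a7'_def[symmetric] a8'_def[symmetric]
      using l AB 3
      by (simp add: vec3_eq_iff x_def[symmetric] y_def[symmetric] z_def[symmetric]
          A_def[symmetric] B_def[symmetric])
        (simp add: x'_def y'_def algebra_simps)
  qed
  have conj': "?X (rotate_z c (- s) v) = rotate_z c (- s) (?Y v)" for v
    using conj[of "rotate_z c (- s) v"] rotate_z_inverse[of c s] rotate_z_inverse[of c "- s"] cs
    by (metis minus_minus power2_minus)
  have inv: "rotate_z c s (rotate_z c (- s) v) = v" for v
    using rotate_z_inverse[of c "- s"] cs by simp
  have pole: "rotate_z c' s' south_pole = south_pole" for c' s' by (simp add: vec3_eq_iff)
  have cs': "c\<^sup>2 + (- s)\<^sup>2 = 1" using cs by simp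
  note images = sphere_center_image[of "rotate_z c s" "rotate_z c (- s)" south_pole ?Y ?X,
      OF bounded_linear_rotate_z bounded_linear_rotate_z norm_rotate_z[OF cs] inv rotate_z_inverse[OF cs] pole conj]
    sphere_center_image[of "rotate_z c (- s)" "rotate_z c s" south_pole ?X ?Y,
      OF bounded_linear_rotate_z bounded_linear_rotate_z norm_rotate_z[OF cs'] rotate_z_inverse[OF cs] inv pole conj']
  show ?thesis by (rule iffI[OF images])
qed

text \<open>The squared distance is \<open>2 * (1 + z)\<close>, whereas
  \<open>x\<^sup>2 + y\<^sup>2\<close> equals \<open>(1 + z) * (1 - z)\<close> with
  \<open>1 - z > 1\<close>. So \<open>x\<close> and \<open>y\<close> alone control the distance to
  the pole.\<close>

lemma dist_south_pole:
  assumes "q \<in> unit_sphere" "q $ 3 < 0"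
  shows "(dist q south_pole)\<^sup>2 \<le> 2 * ((q $ 1)\<^sup>2 + (q $ 2)\<^sup>2)"
proof -
  have 1: "(q $ 1)\<^sup>2 + (q $ 2)\<^sup>2 = 1 - (q $ 3)\<^sup>2" using assms(1) unfolding unit_sphere_iff by simp
  then have "(q $ 3)\<^sup>2 \<le> 1" by (smt (verit) zero_le_power2)
  then have "- 1 \<le> q $ 3" using abs_square_le_1[of "q $ 3"] by linarith
  have "(dist q south_pole)\<^sup>2 = (q $ 1)\<^sup>2 + (q $ 2)\<^sup>2 + (q $ 3 + 1)\<^sup>2"
    unfolding dist_norm power2_norm_eq_inner inner_vec3 by (simp add: power2_eq_square)
  also have "\<dots> = 2 * (1 + q $ 3)" using 1 by (simp add: power2_eq_square algebra_simps)
  also have "\<dots> \<le> 2 * ((1 + q $ 3) * (1 - q $ 3))"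
    using \<open>- 1 \<le> q $ 3\<close> assms(2) by (intro mult_left_mono) (simp_all add: mult_le_cancel_left1)
  also have "\<dots> = 2 * ((q $ 1)\<^sup>2 + (q $ 2)\<^sup>2)" using 1 by (simp add: power2_eq_square algebra_simps)
  finally show ?thesis .
qed

lemma near_south_pole_nonzero:
  assumes "q \<in> unit_sphere" "q \<noteq> south_pole" "q $ 3 < 0"
  shows "q $ 1 \<noteq> 0 \<or> q $ 2 \<noteq> 0"
  using dist_south_pole[OF assms(1,3)] assms(2) by auto

lemma eventually_nhds_less:
  fixes g :: "real ^ 3 \<Rightarrow> real"
  assumes "continuous_on UNIV g" "g p < c"
  shows "\<forall>\<^sub>F q in nhds p. g q < c"
proof -
  have "open (g -` {..<c})" by (rule open_vimage[OF open_lessThan assms(1)])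
  then have "\<forall>\<^sub>F q in nhds p. q \<in> g -` {..<c}"
    by (rule eventually_nhds_in_open) (use assms(2) in simp)
  then show ?thesis by simp
qed

lemma quadratic_form_neg:
  fixes a b c x y :: real
  assumes "a < 0" "b\<^sup>2 < a * c" "x \<noteq> 0 \<or> y \<noteq> 0"
  shows "a * x\<^sup>2 + 2 * b * (x * y) + c * y\<^sup>2 < 0"
proof -
  have "a * (a * x\<^sup>2 + 2 * b * (x * y) + c * y\<^sup>2) = (a * x + b * y)\<^sup>2 + (a * c - b\<^sup>2) * y\<^sup>2"
    by (simp add: power2_eq_square algebra_simps)
  also have "\<dots> > 0"
  proof (cases "y = 0")
    case True
    then show ?thesis using assms by simp
  next
    case False
    then show ?thesis using assms(2) by (intro add_nonneg_pos mult_pos_pos) auto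
  qed
  finally show ?thesis using assms(1) by (simp add: zero_less_mult_iff)
qed

text \<open>\<open>F\<close> is \<open>d\<close> times the squared length of \<open>w\<close> plus
  the squared length of \<open>adj A\<close> applied to \<open>w\<close>. As
  \<open>A + adj A\<close> is the trace times the identity, the matrix \<open>P\<close> of
  \<open>F\<close> satisfies: \<open>P A\<close> plus its transpose is \<open>2 * d\<close> times
  the trace times the identity. Hence the derivative of \<open>F\<close> starts with
  \<open>- 2 * d * (a4 + a8) * (x\<^sup>2 + y\<^sup>2)\<close>.\<close>

lemma not_center_trace_pos:
  assumes tr: "a4 + a8 > 0" and det: "a4 * a8 - a5 * a7 > 0"
  shows "\<not> sphere_center (quadratic_field a1 a2 a4 a5 a7 a8) south_pole"
proof -
  define d where "d = a4 * a8 - a5 * a7"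
  \<comment> \<open>These are the entries of the symmetric matrix of \<open>F\<close>, with
    \<open>\<beta>\<close> off the diagonal.\<close>
  define \<alpha> \<beta> \<delta> where "\<alpha> = d + a8\<^sup>2 + a7\<^sup>2" and "\<beta> = - (a5 * a8 + a4 * a7)" and "\<delta> = d + a5\<^sup>2 + a4\<^sup>2"
  define F where "F q = d * ((q $ 1)\<^sup>2 + (q $ 2)\<^sup>2) + (a8 * q $ 1 - a5 * q $ 2)\<^sup>2 + (a4 * q $ 2 - a7 * q $ 1)\<^sup>2"
    for q :: "real ^ 3"
  define l where "l q = a1 * q $ 1 + a2 * q $ 2" for q :: "real ^ 3"
  define A where "A q = 2 * \<alpha> * a4 * q $ 3 + 2 * \<beta> * (a7 * q $ 3 - l q)" for q :: "real ^ 3"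
  define B where "B q = \<alpha> * (l q + a5 * q $ 3) + \<beta> * (a4 + a8) * q $ 3 + \<delta> * (a7 * q $ 3 - l q)"
    for q :: "real ^ 3"
  define C where "C q = 2 * \<beta> * (l q + a5 * q $ 3) + 2 * \<delta> * a8 * q $ 3" for q :: "real ^ 3"
  define F' where "F' q = A q * (q $ 1)\<^sup>2 + 2 * B q * (q $ 1 * q $ 2) + C q * (q $ 2)\<^sup>2" for q
  have cont: "continuous_on UNIV A" "continuous_on UNIV B" "continuous_on UNIV C"
    unfolding A_def B_def C_def l_def by (intro continuous_intros)+
  have at_pole: "A south_pole = - 2 * d * (a4 + a8)" "B south_pole = 0" "C south_pole = - 2 * d * (a4 + a8)"
    by (simp_all add: A_def B_def C_def l_def \<alpha>_def \<beta>_def \<delta>_def d_def algebra_simps power2_eq_square)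
  have "d > 0" using det by (simp add: d_def)
  have neg: "- 2 * d * (a4 + a8) < 0" using tr \<open>d > 0\<close> by (simp add: mult_pos_pos mult_neg_pos)
  then have "A south_pole < 0" "(B south_pole)\<^sup>2 - A south_pole * C south_pole < 0"
    using mult_neg_neg[OF neg neg] unfolding at_pole by simp_all
  then have "\<forall>\<^sub>F q in nhds south_pole. A q < 0 \<and> (B q)\<^sup>2 - A q * C q < 0 \<and> q $ 3 < 0"
    by (intro eventually_conj eventually_nhds_less continuous_intros cont) simp_all
  then obtain r where r: "r > 0" "\<And>q. dist q south_pole \<le> r \<Longrightarrow> A q < 0 \<and> (B q)\<^sup>2 - A q * C q < 0 \<and> q $ 3 < 0"
    unfolding eventually_nhds_metric_le by blast
  show ?thesis
  proof (rule lyapunov_not_center[where F = F and F' = F' and r = r])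
    fix \<gamma> t assume sol: "sphere_solution (quadratic_field a1 a2 a4 a5 a7 a8) \<gamma>"
    note * = sphere_solution_component[OF sol, of _ t]
    show "((\<lambda>t. F (\<gamma> t)) has_real_derivative F' (\<gamma> t)) (at t)"
      unfolding F_def
      by (rule derivative_eq_intros refl *)+
        (simp add: F'_def A_def B_def C_def l_def \<alpha>_def \<beta>_def \<delta>_def algebra_simps power2_eq_square)
  next
    fix q :: "real ^ 3" assume q: "q \<in> unit_sphere" "q \<noteq> south_pole" "dist q south_pole \<le> r"
    have nz: "q $ 1 \<noteq> 0 \<or> q $ 2 \<noteq> 0"
      by (rule near_south_pole_nonzero[OF q(1,2)]) (use r(2)[OF q(3)] in simp)
    then have "d * ((q $ 1)\<^sup>2 + (q $ 2)\<^sup>2) > 0"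
      using \<open>d > 0\<close> by (intro mult_pos_pos) (auto simp: sum_power2_gt_zero_iff)
    then have "F q > 0" unfolding F_def by (intro add_pos_nonneg) auto
    moreover have "F' q < 0"
      unfolding F'_def by (rule quadratic_form_neg[OF _ _ nz]) (use r(2)[OF q(3)] in auto)
    ultimately show "F q > 0 \<and> F' q < 0" by simp
  qed (use r in \<open>auto simp: F_def intro!: continuous_intros\<close>)
qed

section \<open>Degenerate and hyperbolic linear parts\<close>

text \<open>The linear part at the pole is \<open>x' = - a4 x\<close>,
  \<open>y' = - a7 x - a8 y\<close>. Because \<open>a4 > a8\<close>, slopes \<open>y / x\<close>
  that are large in absolute value drift outward, so the sides of the wedge
  \<open>\<bar>y\<bar> \<le> M x\<close> are exits, while \<open>a4 > 0\<close> makes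
  \<open>x\<close> decrease inside.\<close>

lemma not_center_real_eigenvalues:
  assumes a4: "a4 > 0" "a4 > a8"
  shows "\<not> sphere_center (quadratic_field a1 a2 a4 0 a7 a8) south_pole"
proof -
  let ?X = "quadratic_field a1 a2 a4 0 a7 a8"
  \<comment> \<open>Both sides are exits at linear order as soon as \<open>M * (a4 - a8)\<close>
    exceeds \<open>\<bar>a7\<bar>\<close>.\<close>
  define M where "M = \<bar>a7\<bar> / (a4 - a8) + 1"
  have M: "M > 0" using a4 by (simp add: M_def add_nonneg_pos)
  have "M * (a4 - a8) = \<bar>a7\<bar> + (a4 - a8)" using a4 by (simp add: M_def field_simps)
  then have Ma7: "M * (a4 - a8) > \<bar>a7\<bar>" using a4 by simp
  define a b v w :: "real ^ 3"
    where "a = vector [M, -1, 0]" and "b = vector [M, 1, 0]"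
      and "v = vector [1 / (2 * M), 1 / 2, 0]" and "w = vector [1 / (2 * M), - 1 / 2, 0]"
  \<comment> \<open>On their respective faces the coordinates \<open>a\<close>, \<open>b\<close>
    have derivatives \<open>x * f\<close> and \<open>x * g\<close>; inside the wedge
    \<open>x * h\<close> bounds the derivative of \<open>x\<close> from above.\<close>
  define f where "f q = M * (a1 * q $ 2 + a2 * M * q $ 2 + a4 * q $ 3) + a1 * q $ 1 + a2 * q $ 2
      - a7 * q $ 3 - a8 * M * q $ 3" for q :: "real ^ 3"
  define g where "g q = M * (a1 * q $ 2 - a2 * M * q $ 2 + a4 * q $ 3) - a1 * q $ 1 - a2 * q $ 2
      + a7 * q $ 3 - a8 * M * q $ 3" for q :: "real ^ 3"
  define h where "h q = a1 * q $ 2 + \<bar>a2\<bar> * M * \<bar>q $ 2\<bar> + a4 * q $ 3" for q :: "real ^ 3"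
  have cont: "continuous_on UNIV f" "continuous_on UNIV g" "continuous_on UNIV h"
    unfolding f_def g_def h_def by (intro continuous_intros)+
  have "f south_pole < 0" "g south_pole < 0" "h south_pole < 0"
    using Ma7 a4 by (simp_all add: f_def g_def h_def algebra_simps)
  then have "\<forall>\<^sub>F q in nhds south_pole. f q < 0 \<and> g q < 0 \<and> h q < 0 \<and> q $ 3 < 0"
    by (intro eventually_conj eventually_nhds_less continuous_intros cont) simp_all
  then obtain r where r: "r > 0"
    "\<And>q. dist q south_pole \<le> r \<Longrightarrow> f q < 0 \<and> g q < 0 \<and> h q < 0 \<and> q $ 3 < 0"
    unfolding eventually_nhds_metric_le by blast
  obtain L where L: "L-lipschitz_on unit_sphere ?X" by (rule quadratic_field_sphere_lipschitz)
  show ?thesis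
  proof (rule wedge_not_center[OF L, where a = a and b = b and v = v and w = w and r = r and K = "(1 + M) / M"])
    fix q assume q: "q \<in> unit_sphere" "q \<noteq> south_pole" "dist q south_pole \<le> r"
      and ab: "0 \<le> a \<bullet> q" "0 \<le> b \<bullet> q"
    define x y z where "x = q $ 1" and "y = q $ 2" and "z = q $ 3"
    note xyz = x_def[symmetric] y_def[symmetric] z_def[symmetric]
    note neg = r(2)[OF q(3)]
    have aq: "a \<bullet> q = M * x - y" "b \<bullet> q = M * x + y"
      by (simp_all add: a_def b_def inner_vec3 xyz)
    have aX: "a \<bullet> ?X q = M * ?X q $ 1 - ?X q $ 2" "b \<bullet> ?X q = M * ?X q $ 1 + ?X q $ 2"
      by (simp_all add: a_def b_def inner_vec3 del: quadratic_field_component)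
    have yM: "\<bar>y\<bar> \<le> M * x" using ab aq by linarith
    then have "0 \<le> M * x" by linarith
    then have "x \<ge> 0" using M by (simp add: zero_le_mult_iff)
    moreover have "x \<noteq> 0"
      using near_south_pole_nonzero[OF q(1,2)] neg yM by (auto simp: xyz)
    ultimately have x: "x > 0" by simp
    have "a \<bullet> ?X q < 0" if "a \<bullet> q = 0"
    proof -
      have y: "y = M * x" using that aq by simp
      have "a \<bullet> ?X q = x * f q"
        unfolding aX quadratic_field_component f_def xyz y by (simp add: power2_eq_square algebra_simps)
      then show ?thesis using x neg by (simp add: mult_pos_neg)
    qed
    moreover have "b \<bullet> ?X q < 0" if "b \<bullet> q = 0"
    proof -
      have y: "y = - (M * x)" using that aq by simp
      have "b \<bullet> ?X q = x * g q"
        unfolding aX quadratic_field_component g_def xyz y by (simp add: power2_eq_square algebra_simps)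
      then show ?thesis using x neg by (simp add: mult_pos_neg)
    qed
    moreover have "(a + b) \<bullet> ?X q < 0"
    proof -
      have "a2 * y\<^sup>2 \<le> \<bar>a2\<bar> * (\<bar>y\<bar> * \<bar>y\<bar>)"
        by (simp add: power2_eq_square mult_right_mono)
      also have "\<dots> \<le> \<bar>a2\<bar> * (\<bar>y\<bar> * (M * x))" using yM by (intro mult_left_mono) auto
      finally have "?X q $ 1 \<le> x * h q"
        unfolding quadratic_field_component h_def xyz by (simp add: algebra_simps)
      also have "\<dots> < 0" using x neg by (simp add: mult_pos_neg)
      finally have "?X q $ 1 < 0" .
      then have "M * ?X q $ 1 < 0" using M by (rule mult_pos_neg[rotated])
      then show ?thesis unfolding inner_add_left aX by linarith
    qed
    moreover have "dist q south_pole \<le> (1 + M) / M * ((a + b) \<bullet> q)"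
    proof -
      have "y\<^sup>2 \<le> (M * x)\<^sup>2" using yM power_mono[of "\<bar>y\<bar>" "M * x" 2] by simp
      then have "2 * (x\<^sup>2 + y\<^sup>2) \<le> 2 * (x\<^sup>2 + (M * x)\<^sup>2)" by simp
      also have "\<dots> \<le> (2 * (1 + M) * x)\<^sup>2"
        using M x by (simp add: power2_eq_square algebra_simps)
      finally have "(dist q south_pole)\<^sup>2 \<le> (2 * (1 + M) * x)\<^sup>2"
        using dist_south_pole[OF q(1)] neg by (simp add: xyz)
      then have "dist q south_pole \<le> 2 * (1 + M) * x"
        by (rule power2_le_imp_le) (use M x in simp)
      also have "\<dots> = (1 + M) / M * ((a + b) \<bullet> q)" using M by (simp add: inner_add_left aq field_simps)
      finally show ?thesis .
    qed
    ultimately show "(a \<bullet> q = 0 \<longrightarrow> a \<bullet> ?X q < 0) \<and> (b \<bullet> q = 0 \<longrightarrow> b \<bullet> ?X q < 0) \<and>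
        (0 < a \<bullet> q \<longrightarrow> 0 < b \<bullet> q \<longrightarrow> (a + b) \<bullet> ?X q < 0) \<and>
        dist q south_pole \<le> (1 + M) / M * ((a + b) \<bullet> q)" by blast
  qed (use M r in \<open>simp_all add: a_def b_def v_def w_def inner_vec3 field_simps\<close>)
qed

text \<open>To leading order \<open>x' = a2 y\<^sup>2\<close> and \<open>y' = - a7 x\<close>. The
  wedge is \<open>0 \<le> x \<le> y\<close>: the quadratic term drives orbits out through
  \<open>x = 0\<close>, the linear one through \<open>x = y\<close>, and \<open>y\<close> decreases
  inside. On the face \<open>x = 0\<close> the derivative of \<open>y\<close> vanishes, which is why
  the wedge condition asks for monotonicity only in the interior.\<close>

lemma not_center_cusp:
  assumes "a7 > 0" "a2 < 0"
  shows "\<not> sphere_center (quadratic_field a1 a2 0 0 a7 0) south_pole"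
proof -
  let ?X = "quadratic_field a1 a2 0 0 a7 0"
  define a b v w :: "real ^ 3"
    where "a = vector [-1, 1, 0]" and "b = vector [1, 0, 0]"
      and "v = vector [1, 1, 0]" and "w = vector [0, 1, 0]"
  define f where "f q = - a1 * q $ 1 - a2 * q $ 2 + a7 * q $ 3 - a1 * q $ 2 - a2 * q $ 2" for q :: "real ^ 3"
  define g where "g q = - a1 * q $ 1 - a2 * q $ 2 + a7 * q $ 3" for q :: "real ^ 3"
  have cont: "continuous_on UNIV f" "continuous_on UNIV g"
    unfolding f_def g_def by (intro continuous_intros)+
  have "f south_pole < 0" "g south_pole < 0" using assms by (simp_all add: f_def g_def)
  then have "\<forall>\<^sub>F q in nhds south_pole. f q < 0 \<and> g q < 0 \<and> q $ 3 < 0"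
    by (intro eventually_conj eventually_nhds_less continuous_intros cont) simp_all
  then obtain r where r: "r > 0" "\<And>q. dist q south_pole \<le> r \<Longrightarrow> f q < 0 \<and> g q < 0 \<and> q $ 3 < 0"
    unfolding eventually_nhds_metric_le by blast
  obtain L where L: "L-lipschitz_on unit_sphere ?X" by (rule quadratic_field_sphere_lipschitz)
  show ?thesis
  proof (rule wedge_not_center[OF L, where a = a and b = b and v = v and w = w and r = r and K = 2])
    fix q assume q: "q \<in> unit_sphere" "q \<noteq> south_pole" "dist q south_pole \<le> r"
      and ab: "0 \<le> a \<bullet> q" "0 \<le> b \<bullet> q"
    define x y z where "x = q $ 1" and "y = q $ 2" and "z = q $ 3"
    note xyz = x_def[symmetric] y_def[symmetric] z_def[symmetric]
    note neg = r(2)[OF q(3)]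
    have aq: "a \<bullet> q = y - x" "b \<bullet> q = x" by (simp_all add: a_def b_def inner_vec3 xyz)
    have aX: "a \<bullet> ?X q = ?X q $ 2 - ?X q $ 1" "b \<bullet> ?X q = ?X q $ 1"
      by (simp_all add: a_def b_def inner_vec3 del: quadratic_field_component)
    have xy: "0 \<le> x" "x \<le> y" using ab aq by simp_all
    have "y \<noteq> 0" using near_south_pole_nonzero[OF q(1,2)] neg xy by (auto simp: xyz)
    then have y: "y > 0" using xy by simp
    have "a \<bullet> ?X q < 0" if "a \<bullet> q = 0"
    proof -
      have x: "x = y" using that aq by simp
      have "a \<bullet> ?X q = y * f q"
        unfolding aX quadratic_field_component f_def xyz x by (simp add: power2_eq_square algebra_simps)
      then show ?thesis using y neg by (simp add: mult_pos_neg)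
    qed
    moreover have "b \<bullet> ?X q < 0" if "b \<bullet> q = 0"
    proof -
      have "x = 0" using that aq by simp
      then show ?thesis using y assms by (simp add: aX xyz mult_neg_pos)
    qed
    moreover have "(a + b) \<bullet> ?X q < 0" if "0 < b \<bullet> q"
    proof -
      have "(a + b) \<bullet> ?X q = x * g q"
        unfolding inner_add_left aX quadratic_field_component g_def xyz by (simp add: power2_eq_square algebra_simps)
      then show ?thesis using that neg by (simp add: aq mult_pos_neg)
    qed
    moreover have "dist q south_pole \<le> 2 * ((a + b) \<bullet> q)"
    proof -
      have "x\<^sup>2 \<le> y\<^sup>2" using xy by (simp add: power_mono)
      then have "(dist q south_pole)\<^sup>2 \<le> (2 * y)\<^sup>2"
        using dist_south_pole[OF q(1)] neg by (simp add: xyz power_mult_distrib)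
      then have "dist q south_pole \<le> 2 * y" by (rule power2_le_imp_le) (use y in simp)
      then show ?thesis by (simp add: inner_add_left aq)
    qed
    ultimately show "(a \<bullet> q = 0 \<longrightarrow> a \<bullet> ?X q < 0) \<and> (b \<bullet> q = 0 \<longrightarrow> b \<bullet> ?X q < 0) \<and>
        (0 < a \<bullet> q \<longrightarrow> 0 < b \<bullet> q \<longrightarrow> (a + b) \<bullet> ?X q < 0) \<and>
        dist q south_pole \<le> 2 * ((a + b) \<bullet> q)" by blast
  qed (use r in \<open>simp_all add: a_def b_def v_def w_def inner_vec3\<close>)
qed

text \<open>The field vanishes on a plane containing the z-axis, hence on a great circle through the
  pole. By uniqueness, solutions starting there are constant, but a center demands nonconstant
  ones.\<close>

lemma not_center_singular_direction:
  assumes X: "L-lipschitz_on unit_sphere X" and cs: "c\<^sup>2 + s\<^sup>2 = 1"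
    and sing: "\<And>t z. X (vector [c * t, s * t, z]) = 0"
  shows "\<not> sphere_center X south_pole"
proof
  assume "sphere_center X south_pole"
  then obtain \<rho> where \<rho>: "\<rho> > 0"
    "\<And>q. q \<in> unit_sphere \<Longrightarrow> q \<noteq> south_pole \<Longrightarrow> dist q south_pole < \<rho> \<Longrightarrow> periodic_through X south_pole q"
    unfolding sphere_center_iff by blast
  define t where "t = min (\<rho> / 2) (1 / 2)"
  have t: "0 < t" "t \<le> \<rho> / 2" "t\<^sup>2 < 1"
    using \<rho>(1) by (auto simp: t_def abs_square_less_1)
  define q :: "real ^ 3" where "q = vector [c * t, s * t, - sqrt (1 - t\<^sup>2)]"
  have ct: "(c * t)\<^sup>2 + (s * t)\<^sup>2 = t\<^sup>2"
    using cs by (simp add: power_mult_distrib flip: distrib_right)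
  have q: "q \<in> unit_sphere" using ct t by (simp only: unit_sphere_iff q_def vector_3) simp
  have "q \<noteq> south_pole"
  proof
    assume "q = south_pole"
    then have "c * t = 0" "s * t = 0" by (simp_all add: q_def vec3_eq_iff)
    then show False using ct t by simp
  qed
  moreover have "dist q south_pole < \<rho>"
  proof -
    have "(dist q south_pole)\<^sup>2 \<le> 2 * t\<^sup>2"
      using dist_south_pole[OF q] t ct by (simp add: q_def)
    also have "\<dots> < (2 * t)\<^sup>2" using t by (simp add: power_mult_distrib)
    finally have "dist q south_pole < 2 * t" by (rule power2_less_imp_less) (use t in simp)
    then show ?thesis using t by simp
  qed
  ultimately obtain \<gamma> where \<gamma>: "sphere_solution X \<gamma>" "\<gamma> 0 = q" "\<not> \<gamma> constant_on UNIV"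
    using \<rho>(2)[OF q] unfolding periodic_through_def by blast
  have "sphere_solution X (\<lambda>_. q)"
    using q sing by (simp add: sphere_solution_def q_def)
  then have "\<gamma> t = q" for t
    using sphere_solution_unique[OF X \<gamma>(1), of "\<lambda>_. q" 0] \<gamma>(2) by simp
  then show False using \<gamma>(3) unfolding constant_on_def by auto
qed

section \<open>Weak foci\<close>

text \<open>By \<open>2 * \<bar>x * y\<bar> \<le> x\<^sup>2 + y\<^sup>2\<close>, each odd mixed term
  is shared equally between its two even neighbours.\<close>

lemma quartic_form_neg:
  fixes x y :: real
  assumes "2 * a + \<bar>b\<bar> < 0" "2 * c + \<bar>b\<bar> + \<bar>d\<bar> < 0" "2 * e + \<bar>d\<bar> < 0" "x \<noteq> 0 \<or> y \<noteq> 0"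
  shows "a * x ^ 4 + b * (x ^ 3 * y) + c * (x\<^sup>2 * y\<^sup>2) + d * (x * y ^ 3) + e * y ^ 4 < 0"
proof -
  have xy: "2 * \<bar>x * y\<bar> \<le> x\<^sup>2 + y\<^sup>2"
    using sum_squares_bound[of "\<bar>x\<bar>" "\<bar>y\<bar>"] by (simp add: abs_mult)
  have t: "\<bar>b * x\<^sup>2 + d * y\<^sup>2\<bar> \<le> \<bar>b\<bar> * x\<^sup>2 + \<bar>d\<bar> * y\<^sup>2"
    using abs_triangle_ineq[of "b * x\<^sup>2" "d * y\<^sup>2"] by (simp add: abs_mult)
  have "2 * (x * y * (b * x\<^sup>2 + d * y\<^sup>2)) \<le> 2 * \<bar>x * y\<bar> * \<bar>b * x\<^sup>2 + d * y\<^sup>2\<bar>"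
    unfolding mult.assoc abs_mult[symmetric] by (intro mult_left_mono abs_ge_self) simp
  also have "\<dots> \<le> (x\<^sup>2 + y\<^sup>2) * (\<bar>b\<bar> * x\<^sup>2 + \<bar>d\<bar> * y\<^sup>2)"
    by (intro mult_mono xy t) simp_all
  finally have le: "2 * (x * y * (b * x\<^sup>2 + d * y\<^sup>2)) \<le> (x\<^sup>2 + y\<^sup>2) * (\<bar>b\<bar> * x\<^sup>2 + \<bar>d\<bar> * y\<^sup>2)" .
  have e1: "2 * (a * x ^ 4 + b * (x ^ 3 * y) + c * (x\<^sup>2 * y\<^sup>2) + d * (x * y ^ 3) + e * y ^ 4) =
      2 * (a * x ^ 4) + 2 * (c * (x\<^sup>2 * y\<^sup>2)) + 2 * (e * y ^ 4) + 2 * (x * y * (b * x\<^sup>2 + d * y\<^sup>2))"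
    by algebra
  have e2: "(2 * a + \<bar>b\<bar>) * x ^ 4 + (2 * c + \<bar>b\<bar> + \<bar>d\<bar>) * (x\<^sup>2 * y\<^sup>2) + (2 * e + \<bar>d\<bar>) * y ^ 4 =
      2 * (a * x ^ 4) + 2 * (c * (x\<^sup>2 * y\<^sup>2)) + 2 * (e * y ^ 4) + (x\<^sup>2 + y\<^sup>2) * (\<bar>b\<bar> * x\<^sup>2 + \<bar>d\<bar> * y\<^sup>2)"
    by algebra
  have lt: "(2 * a + \<bar>b\<bar>) * x ^ 4 + (2 * c + \<bar>b\<bar> + \<bar>d\<bar>) * (x\<^sup>2 * y\<^sup>2) +
      (2 * e + \<bar>d\<bar>) * y ^ 4 < 0"
  proof -
    have *: "(2 * a + \<bar>b\<bar>) * x ^ 4 \<le> 0" "(2 * c + \<bar>b\<bar> + \<bar>d\<bar>) * (x\<^sup>2 * y\<^sup>2) \<le> 0"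
      "(2 * e + \<bar>d\<bar>) * y ^ 4 \<le> 0"
      using assms(1-3) by (intro mult_nonpos_nonneg; simp)+
    from assms(4) show ?thesis
    proof
      assume "x \<noteq> 0"
      then have "(2 * a + \<bar>b\<bar>) * x ^ 4 < 0" using assms(1) by (intro mult_neg_pos) auto
      then show ?thesis using * by linarith
    next
      assume "y \<noteq> 0"
      then have "(2 * e + \<bar>d\<bar>) * y ^ 4 < 0" using assms(3) by (intro mult_neg_pos) auto
      then show ?thesis using * by linarith
    qed
  qed
  have half: "u < 0" if "2 * u < 0" for u :: real using that by simp
  show ?thesis
    by (rule half, rule le_less_trans[OF _ lt], unfold e1 e2) (rule add_left_mono[OF le])
qed

text \<open>The cubic part of \<open>F\<close> is chosen such that the derivative of
  \<open>- 24 b\<^sup>2 d\<^sup>2 z (d x\<^sup>2 + b y\<^sup>2) - 16 b d\<^sup>2 k a1 x\<^sup>3 + 16 b\<^sup>2 d k a2 y\<^sup>3\<close> is a quartic form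
  in \<open>x, y\<close>; the quartic terms then turn that form into a multiple of \<open>(d x\<^sup>2 + b y\<^sup>2)\<^sup>2\<close> up to
  terms of order five. The factor \<open>\<sigma>\<close> serves to reverse time.\<close>

lemma not_center_weak_focus_scaled:
  assumes b: "b > 0" and d: "d > 0" and \<sigma>: "\<sigma> * (a1 * a2 * (d - b)) > 0"
  shows "\<not> sphere_center (\<lambda>v. \<sigma> *\<^sub>R quadratic_field a1 a2 0 (-b) d 0 v) south_pole"
proof -
  let ?X = "quadratic_field a1 a2 0 (-b) d 0"
  define k where "k = d - b"
  define m where "m = k * a1 * a2 * (b + d)"
  \<comment> \<open>As coefficients of \<open>x^4\<close> and \<open>y^4\<close> in
    \<open>F\<close>, \<open>p1\<close> and \<open>p2\<close> are chosen so that \<open>C31\<close>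
    and \<open>C13\<close> contain the factors \<open>A q - b\<close> and \<open>B q - d\<close>,
    which vanish at the pole. The terms of \<open>F\<close> in \<open>x^3 y\<close> and
    \<open>x y^3\<close> carry \<open>m\<close>.\<close>
  define p1 where "p1 = 6 * k * d\<^sup>2 * (2 * a1\<^sup>2 - b * d)"
  define p2 where "p2 = - 6 * k * b\<^sup>2 * (2 * a2\<^sup>2 - b * d)"
  define A where "A q = a1 * q $ 1 + a2 * q $ 2 - b * q $ 3" for q :: "real ^ 3"
  define B where "B q = a1 * q $ 1 + a2 * q $ 2 - d * q $ 3" for q :: "real ^ 3"
  \<comment> \<open>Absorbing the cubic and quartic terms into coefficients of
    \<open>x\<^sup>2\<close> and \<open>y\<^sup>2\<close> lets positivity of \<open>F\<close> follow
    from the signs of \<open>f\<close> and \<open>g\<close> at the pole.\<close>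
  define f where "f q = - 24 * b\<^sup>2 * d\<^sup>2 * d * q $ 3 - 16 * b * d\<^sup>2 * k * a1 * q $ 1
      + p1 * (q $ 1)\<^sup>2 + 6 * m * d * (q $ 1 * q $ 2)" for q :: "real ^ 3"
  define g where "g q = - 24 * b\<^sup>2 * d\<^sup>2 * b * q $ 3 + 16 * b\<^sup>2 * d * k * a2 * q $ 2
      + p2 * (q $ 2)\<^sup>2 - 6 * m * b * (q $ 1 * q $ 2)" for q :: "real ^ 3"
  define F where "F q = f q * (q $ 1)\<^sup>2 + g q * (q $ 2)\<^sup>2" for q :: "real ^ 3"
  define C40 where "C40 q = \<sigma> * (- 6 * m * d * B q)" for q
  define C31 where "C31 q = \<sigma> * (4 * p1 * (A q - b))" for q
  define C22 where "C22 q = \<sigma> * (- 48 * m * b * d + 18 * m * d * A q + 18 * m * b * B q)" for q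
  define C13 where "C13 q = \<sigma> * (- 4 * p2 * (B q - d))" for q
  define C04 where "C04 q = \<sigma> * (- 6 * m * b * A q)" for q
  define F' where "F' q = C40 q * (q $ 1) ^ 4 + C31 q * ((q $ 1) ^ 3 * q $ 2) +
      C22 q * ((q $ 1)\<^sup>2 * (q $ 2)\<^sup>2) + C13 q * (q $ 1 * (q $ 2) ^ 3) + C04 q * (q $ 2) ^ 4" for q
  have m: "\<sigma> * m > 0"
    using \<sigma> b d mult_pos_pos[OF \<sigma>, of "b + d"] by (simp add: m_def k_def algebra_simps)
  have contAB: "continuous_on UNIV A" "continuous_on UNIV B"
    unfolding A_def B_def by (intro continuous_intros)+
  have cont: "continuous_on UNIV f" "continuous_on UNIV g" "continuous_on UNIV C40" "continuous_on UNIV C31"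
    "continuous_on UNIV C22" "continuous_on UNIV C13" "continuous_on UNIV C04"
    unfolding f_def g_def C40_def C31_def C22_def C13_def C04_def by (intro continuous_intros contAB)+
  have pole: "A south_pole = b" "B south_pole = d" by (simp_all add: A_def B_def)
  have "C31 south_pole = 0" "C13 south_pole = 0" by (simp_all add: C31_def C13_def pole)
  \<comment> \<open>At the pole the coefficients are those of
    \<open>(d x\<^sup>2 + b y\<^sup>2)\<^sup>2\<close> times \<open>- 6 * \<sigma> * m\<close>, so
    \<open>m\<close> plays the part of the first Lyapunov coefficient.\<close>
  moreover have "C40 south_pole = - 6 * d\<^sup>2 * (\<sigma> * m)" "C22 south_pole = - 12 * b * d * (\<sigma> * m)"
    "C04 south_pole = - 6 * b\<^sup>2 * (\<sigma> * m)"
    by (simp_all add: C40_def C22_def C04_def pole power2_eq_square algebra_simps)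
  then have "C40 south_pole < 0" "C22 south_pole < 0" "C04 south_pole < 0"
    using b d m by (simp_all add: mult_pos_pos mult_neg_pos)
  moreover have "- f south_pole < 0" "- g south_pole < 0"
    using b d by (simp_all add: f_def g_def)
  ultimately have "\<forall>\<^sub>F q in nhds south_pole. - f q < 0 \<and> - g q < 0 \<and> 2 * C40 q + \<bar>C31 q\<bar> < 0 \<and>
      2 * C22 q + \<bar>C31 q\<bar> + \<bar>C13 q\<bar> < 0 \<and> 2 * C04 q + \<bar>C13 q\<bar> < 0 \<and> q $ 3 < 0"
    by (intro eventually_conj eventually_nhds_less continuous_intros cont) simp_all
  then obtain r where r: "r > 0"
    "\<And>q. dist q south_pole \<le> r \<Longrightarrow> - f q < 0 \<and> - g q < 0 \<and> 2 * C40 q + \<bar>C31 q\<bar> < 0 \<and>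
      2 * C22 q + \<bar>C31 q\<bar> + \<bar>C13 q\<bar> < 0 \<and> 2 * C04 q + \<bar>C13 q\<bar> < 0 \<and> q $ 3 < 0"
    unfolding eventually_nhds_metric_le by blast
  show ?thesis
  proof (rule lyapunov_not_center[where F = F and F' = F' and r = r])
    fix \<gamma> t assume sol: "sphere_solution (\<lambda>v. \<sigma> *\<^sub>R ?X v) \<gamma>"
    define x y z where "x = \<gamma> t $ 1" and "y = \<gamma> t $ 2" and "z = \<gamma> t $ 3"
    define l where "l = a1 * x + a2 * y"
    have l: "A (\<gamma> t) = l - b * z" "B (\<gamma> t) = l - d * z"
      by (simp_all add: A_def B_def l_def x_def y_def z_def)
    have *: "((\<lambda>t. \<gamma> t $ 1) has_real_derivative \<sigma> * (y * (l - b * z))) (at t)"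
      "((\<lambda>t. \<gamma> t $ 2) has_real_derivative \<sigma> * (- x * (l - d * z))) (at t)"
      "((\<lambda>t. \<gamma> t $ 3) has_real_derivative \<sigma> * (- k * (x * y))) (at t)"
      using sphere_solution_component[OF sol, of 1 t] sphere_solution_component[OF sol, of 2 t]
        sphere_solution_component[OF sol, of 3 t]
      by (simp_all add: k_def l_def x_def y_def z_def power2_eq_square algebra_simps)
    show "((\<lambda>t. F (\<gamma> t)) has_real_derivative F' (\<gamma> t)) (at t)"
      unfolding F_def f_def g_def
      by (rule derivative_eq_intros refl *)+
        (simp add: x_def[symmetric] y_def[symmetric] z_def[symmetric] F'_def C40_def C31_def C22_def
          C13_def C04_def l p1_def p2_def m_def k_def l_def power2_eq_square power3_eq_cube
          power4_eq_xxxx algebra_simps)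
  next
    fix q :: "real ^ 3" assume q: "q \<in> unit_sphere" "q \<noteq> south_pole" "dist q south_pole \<le> r"
    note near = r(2)[OF q(3)]
    have nz: "q $ 1 \<noteq> 0 \<or> q $ 2 \<noteq> 0"
      by (rule near_south_pole_nonzero[OF q(1,2)]) (use near in simp)
    have "f q > 0" "g q > 0" using near by auto
    then have "F q > 0"
      unfolding F_def using nz by (auto intro: add_pos_nonneg add_nonneg_pos)
    moreover have "F' q < 0"
      unfolding F'_def by (rule quartic_form_neg[OF _ _ _ nz]) (use near in auto)
    ultimately show "F q > 0 \<and> F' q < 0" by simp
  qed (use r cont in \<open>auto simp: F_def intro!: continuous_intros\<close>)
qed

section \<open>Reversible centers\<close>

lemma not_center_weak_focus:
  assumes "b > 0" "d > 0" "a1 * a2 * (d - b) \<noteq> 0"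
  shows "\<not> sphere_center (quadratic_field a1 a2 0 (-b) d 0) south_pole"
proof (cases "a1 * a2 * (d - b) > 0")
  case True
  then show ?thesis using not_center_weak_focus_scaled[OF assms(1,2), of 1] by simp
next
  case False
  then have "\<not> sphere_center (\<lambda>v. - quadratic_field a1 a2 0 (-b) d 0 v) south_pole"
    using not_center_weak_focus_scaled[OF assms(1,2), of "-1" a1 a2] assms(3) by simp
  then show ?thesis using sphere_center_uminus by blast
qed

text \<open>The point to settle is that an orbit does reach the plane \<open>x = 0\<close> twice
  before it can leave the region of control. This comes from a lower bound \<open>m\<close> on the
  angular speed around the pole.\<close>

lemma reversible_center:
  assumes b: "b > 0" and d: "d > 0"
  shows "sphere_center (quadratic_field 0 a2 0 (-b) d 0) south_pole"
proof -
  let ?X = "quadratic_field 0 a2 0 (-b) d 0"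
  define m where "m = min b d / 2"
  have m: "m > 0" "m < b" "m < d" using b d by (auto simp: m_def)
  define A where "A q = a2 * q $ 2 - b * q $ 3" for q :: "real ^ 3"
  define B where "B q = a2 * q $ 2 - d * q $ 3" for q :: "real ^ 3"
  have X: "?X q $ 1 = q $ 2 * A q" "?X q $ 2 = - (q $ 1 * B q)" for q
    by (simp_all add: A_def B_def power2_eq_square algebra_simps)
  have "\<forall>\<^sub>F q in nhds south_pole. - A q < - m \<and> - B q < - m \<and> q $ 3 < 0"
    unfolding A_def B_def
    by (intro eventually_conj eventually_nhds_less continuous_intros) (use m in simp_all)
  then obtain r where r: "r > 0"
    "\<And>q. dist q south_pole \<le> r \<Longrightarrow> - A q < - m \<and> - B q < - m \<and> q $ 3 < 0"
    unfolding eventually_nhds_metric_le by blast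
  obtain L where L: "L-lipschitz_on unit_sphere ?X" by (rule quadratic_field_sphere_lipschitz)
  have "L \<ge> 0" using L lipschitz_on_def by blast
  define \<tau> where "\<tau> = pi / m"
  have \<tau>: "\<tau> > 0" "m * \<tau> = pi" using m by (simp_all add: \<tau>_def)
  \<comment> \<open>Room for two windows of length \<open>\<tau>\<close> separated by a gap of 1, so
    that the two zeros of \<open>x\<close> are distinct. By Gronwall, \<open>\<rho>\<close> keeps
    the orbit within distance \<open>r\<close> up to time \<open>T\<close>.\<close>
  define T where "T = 2 * \<tau> + 1"
  define \<rho> where "\<rho> = r / exp (L * T)"
  have "\<rho> > 0" using r(1) by (simp add: \<rho>_def)
  have pole: "sphere_solution ?X (\<lambda>_. south_pole)"
    using sphere_singularity_south_pole[of 0 a2 0 "-b" d 0]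
    by (simp add: sphere_solution_def sphere_singularity_def)
  have "periodic_through ?X south_pole q"
    if q: "q \<in> unit_sphere" "q \<noteq> south_pole" "dist q south_pole < \<rho>" for q
  proof -
    obtain \<gamma> where \<gamma>: "sphere_solution ?X \<gamma>" "\<gamma> 0 = q"
      using quadratic_field_solution[OF q(1)] by blast
    have away: "\<gamma> t \<noteq> south_pole" for t
      using sphere_solution_unique[OF L \<gamma>(1) pole, of t 0] \<gamma>(2) q(2) by auto
    define x y where "x t = \<gamma> t $ 1" and "y t = \<gamma> t $ 2" for t
    have dx: "(x has_real_derivative y t * A (\<gamma> t)) (at t)"
      and dy: "(y has_real_derivative - (x t * B (\<gamma> t))) (at t)" for t
      using sphere_solution_component[OF \<gamma>(1), of 1 t] sphere_solution_component[OF \<gamma>(1), of 2 t]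
      unfolding X x_def y_def by simp_all
    have near: "dist (\<gamma> t) south_pole \<le> r" if t: "0 \<le> t" "t \<le> T" for t
    proof -
      have "dist (\<gamma> t) south_pole \<le> exp (L * t) * dist (\<gamma> 0) south_pole"
        by (rule sphere_solution_growth[OF L \<gamma>(1) pole t(1)])
      also have "\<dots> \<le> exp (L * T) * \<rho>"
        using t q(3) \<gamma>(2) \<open>L \<ge> 0\<close> by (intro mult_mono) (auto simp: mult_left_mono)
      finally show ?thesis by (simp add: \<rho>_def)
    qed
    have zero: "\<exists>t\<in>{s..s + \<tau>}. x t = 0" if s: "0 \<le> s" "s + \<tau> \<le> T" for s
    proof (rule ccontr)
      assume "\<not> ?thesis"
      then have nz: "x t \<noteq> 0" if "s \<le> t" "t \<le> s + \<tau>" for t using that by auto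
      \<comment> \<open>That \<open>\<theta>\<close> does not increase means that the angle drops by
        at least \<open>m * \<tau> = pi\<close> during the window, more than the open range of
        \<open>arctan\<close> allows.\<close>
      define \<theta> where "\<theta> t = arctan (y t / x t) + m * t" for t
      have "\<theta> (s + \<tau>) \<le> \<theta> s"
      proof (rule DERIV_nonpos_imp_nonincreasing[where f = \<theta>])
        fix t assume t: "s \<le> t" "t \<le> s + \<tau>"
        note x0 = nz[OF t]
        define R where "R = (x t)\<^sup>2 + (y t)\<^sup>2"
        define D where "D = B (\<gamma> t) * (x t)\<^sup>2 + A (\<gamma> t) * (y t)\<^sup>2"
        have R: "R > 0" using x0 by (simp add: R_def sum_power2_gt_zero_iff)
        have "m \<le> A (\<gamma> t)" "m \<le> B (\<gamma> t)" using r(2)[OF near, of t] t s by auto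
        then have "m * (x t)\<^sup>2 + m * (y t)\<^sup>2 \<le> D"
          unfolding D_def by (intro add_mono mult_right_mono) auto
        then have mR: "m * R \<le> D" by (simp add: R_def distrib_left)
        have "((\<lambda>t. arctan (y t / x t)) has_real_derivative - D / R) (at t)"
        proof -
          have "((\<lambda>t. arctan (y t / x t)) has_real_derivative
              inverse (1 + (y t / x t)\<^sup>2) * ((- (x t * B (\<gamma> t)) * x t - y t * (y t * A (\<gamma> t))) / (x t * x t))) (at t)"
            by (rule DERIV_chain2[OF DERIV_arctan DERIV_divide[OF dy dx x0]])
          moreover have "inverse (1 + (y t / x t)\<^sup>2) = (x t)\<^sup>2 / R"
            using x0 R by (simp add: R_def power_divide field_simps)
          moreover have "- (x t * B (\<gamma> t)) * x t - y t * (y t * A (\<gamma> t)) = - D"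
            by (simp add: D_def power2_eq_square algebra_simps)
          ultimately show ?thesis using x0 by (simp add: power2_eq_square)
        qed
        then have "(\<theta> has_real_derivative - D / R + m) (at t)"
          unfolding \<theta>_def by (rule DERIV_add) (auto intro!: derivative_eq_intros)
        moreover have "- D / R + m \<le> 0" using mR R by (simp add: field_simps)
        ultimately show "\<exists>l. (\<theta> has_real_derivative l) (at t) \<and> l \<le> 0" by blast
      qed (use \<tau> in simp)
      then have "arctan (y (s + \<tau>) / x (s + \<tau>)) + pi \<le> arctan (y s / x s)"
        using \<tau>(2) by (simp add: \<theta>_def distrib_left)
      then show False
        using arctan_ubound[of "y s / x s"] arctan_lbound[of "y (s + \<tau>) / x (s + \<tau>)"] by linarith
    qed
    obtain t1 t2 where t: "x t1 = 0" "x t2 = 0" "t1 < t2"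
    proof -
      obtain t1 where "t1 \<in> {0..0 + \<tau>}" "x t1 = 0" using zero[of 0] \<tau>(1) by (auto simp: T_def)
      moreover obtain t2 where "t2 \<in> {\<tau> + 1..\<tau> + 1 + \<tau>}" "x t2 = 0"
        using zero[of "\<tau> + 1"] \<tau>(1) by (auto simp: T_def)
      ultimately show ?thesis by (intro that[of t1 t2]) auto
    qed
    define S :: "real ^ 3 \<Rightarrow> real ^ 3" where "S v = vector [- v $ 1, v $ 2, v $ 3]" for v
    have S: "bounded_linear S"
      by (intro linear_conv_bounded_linear[THEN iffD1] linearI) (simp_all add: S_def vec3_eq_iff)
    have SS: "S (S v) = v" for v by (simp add: S_def vec3_eq_iff)
    have S_sphere: "S v \<in> unit_sphere" if "v \<in> unit_sphere" for v
      using that by (simp only: unit_sphere_iff S_def vector_3) simp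
    have XS: "?X (S v) = - S (?X v)" for v by (simp add: S_def vec3_eq_iff)
    have reflect: "\<gamma> (u + t0) = S (\<gamma> (- u + t0))" if "x t0 = 0" for t0 u
    proof -
      have sol: "sphere_solution ?X (\<lambda>u. \<gamma> (u + t0))" by (rule sphere_solution_shift[OF \<gamma>(1)])
      have "sphere_solution ?X (\<lambda>u. S (\<gamma> (- u + t0)))"
        by (rule sphere_solution_image_reverse[OF sol S S_sphere XS])
      moreover have "\<gamma> (0 + t0) = S (\<gamma> (- 0 + t0))" using that by (simp add: S_def vec3_eq_iff x_def)
      ultimately show ?thesis using sphere_solution_unique[OF L sol, of "\<lambda>u. S (\<gamma> (- u + t0))" 0 u] by simp
    qed
    \<comment> \<open>The time reflections at \<open>t1\<close> and \<open>t2\<close> compose to a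
      translation by \<open>2 * (t2 - t1)\<close>, and the two spatial reflections cancel.\<close>
    have per: "\<gamma> (t + 2 * (t2 - t1)) = \<gamma> t" for t
    proof -
      have "\<gamma> (t + 2 * (t2 - t1)) = S (\<gamma> (2 * t1 - t))"
        using reflect[OF t(2), of "t + t2 - 2 * t1"] by (simp add: algebra_simps)
      also have "\<gamma> (2 * t1 - t) = S (\<gamma> t)"
        using reflect[OF t(1), of "t1 - t"] by (simp add: algebra_simps)
      finally show ?thesis by (simp add: SS)
    qed
    have "\<not> \<gamma> constant_on UNIV"
    proof
      assume "\<gamma> constant_on UNIV"
      then obtain c where "\<And>t. \<gamma> t = c" unfolding constant_on_def by auto
      then have "\<gamma> = (\<lambda>_. q)" using \<gamma>(2) by auto
      then have "((\<lambda>_. q) has_vector_derivative ?X q) (at 0)"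
        using sphere_solution_derivative[OF \<gamma>(1), of 0] by simp
      then have "?X q = 0" using vector_derivative_unique_at has_vector_derivative_const by blast
      then have "q $ 2 * A q = 0" "q $ 1 * B q = 0" using X[of q] by (metis zero_index neg_equal_0_iff_equal)+
      moreover have rq: "- A q < - m \<and> - B q < - m \<and> q $ 3 < 0"
        using r(2)[OF near[of 0]] \<gamma>(2) \<tau>(1) by (simp add: T_def)
      ultimately have "q $ 1 = 0" "q $ 2 = 0" using m(1) by auto
      then show False using near_south_pole_nonzero[OF q(1,2)] rq by simp
    qed
    then show ?thesis
      unfolding periodic_through_def using \<gamma> per away t(3)
      by (intro exI[of _ \<gamma>] exI[of _ "2 * (t2 - t1)"]) simp
  qed
  then show ?thesis
    unfolding sphere_center_iff using sphere_singularity_south_pole \<open>\<rho> > 0\<close> by blast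
qed

section \<open>Unit vectors defining the normalizing rotations\<close>

lemma kernel_direction:
  fixes u v :: real
  obtains c s where "c\<^sup>2 + s\<^sup>2 = 1" "c * u + s * v = 0"
proof (cases "u = 0 \<and> v = 0")
  case True
  then show ?thesis by (intro that[of 1 0]) auto
next
  case False
  define n where "n = sqrt (u\<^sup>2 + v\<^sup>2)"
  have n: "n \<noteq> 0" "n\<^sup>2 = u\<^sup>2 + v\<^sup>2" using False by (auto simp: n_def sum_power2_eq_zero_iff)
  have "(v / n)\<^sup>2 + (- u / n)\<^sup>2 = (u\<^sup>2 + v\<^sup>2) / n\<^sup>2"
    by (simp add: power_divide add_divide_distrib)
  then have "(v / n)\<^sup>2 + (- u / n)\<^sup>2 = 1" using n False by simp
  then show ?thesis by (intro that[of "v / n" "- u / n"]) simp_all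
qed

text \<open>Since the determinant of \<open>A - \<mu>\<close> is zero, a vector orthogonal to a
  nonzero column is orthogonal to the other one too. Used as first row of a rotation, it turns the
  first row of \<open>A\<close> into \<open>(\<mu>, 0)\<close>.\<close>

lemma left_eigenvector:
  fixes a4 a5 a7 a8 \<mu> :: real
  assumes "(a4 - \<mu>) * (a8 - \<mu>) = a5 * a7"
  obtains c s where "c\<^sup>2 + s\<^sup>2 = 1" "c * a4 + s * a7 = c * \<mu>" "c * a5 + s * a8 = s * \<mu>"
proof -
  obtain c s where "c\<^sup>2 + s\<^sup>2 = 1" "c * (a4 - \<mu>) + s * a7 = 0" "c * a5 + s * (a8 - \<mu>) = 0"
  proof (cases "a7 = 0 \<and> a4 - \<mu> = 0")
    case True
    then show ?thesis using that by (auto intro: kernel_direction[of a5 "a8 - \<mu>"])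
  next
    case False
    obtain c s where cs: "c\<^sup>2 + s\<^sup>2 = 1" "c * (a4 - \<mu>) + s * a7 = 0" by (rule kernel_direction)
    have "a7 * (c * a5 + s * (a8 - \<mu>)) = (a8 - \<mu>) * (c * (a4 - \<mu>) + s * a7)"
      "(a4 - \<mu>) * (c * a5 + s * (a8 - \<mu>)) = a5 * (c * (a4 - \<mu>) + s * a7)"
      using assms by algebra+
    then have "c * a5 + s * (a8 - \<mu>) = 0" using cs(2) False by auto
    then show ?thesis using that cs by blast
  qed
  then show ?thesis by (intro that[of c s]) (simp_all add: algebra_simps)
qed

text \<open>The slope \<open>t = s / c\<close> solves a quadratic equation with discriminant
  \<open>k\<^sup>2 + 4 * a\<^sup>2\<close>. Rotating a trace-free \<open>A\<close> by such a
  direction clears its diagonal.\<close>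

lemma isotropic_direction:
  fixes a k :: real
  obtains c s where "c\<^sup>2 + s\<^sup>2 = 1" "c\<^sup>2 * a + c * s * k - s\<^sup>2 * a = 0"
proof (cases "a = 0")
  case True
  then show ?thesis by (intro that[of 1 0]) auto
next
  case False
  define D where "D = sqrt (k\<^sup>2 + 4 * a\<^sup>2)"
  define t where "t = (k + D) / (2 * a)"
  have "D\<^sup>2 = k\<^sup>2 + 4 * a\<^sup>2" by (simp add: D_def)
  then have "4 * a * (a + t * k - t\<^sup>2 * a) = 0"
    using False by (simp add: t_def power2_eq_square field_simps)
  then have root: "a + t * k - t\<^sup>2 * a = 0" using False by simp
  obtain c s where cs: "c\<^sup>2 + s\<^sup>2 = 1" "c * t + s * (- 1) = 0" by (rule kernel_direction)
  then have "s = c * t" by simp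
  then have "c\<^sup>2 * a + c * s * k - s\<^sup>2 * a = c\<^sup>2 * (a + t * k - t\<^sup>2 * a)"
    by (simp add: power2_eq_square algebra_simps)
  then show ?thesis using that cs root by simp
qed

section \<open>Classification\<close>

lemma rotated_det:
  fixes a4 a5 a7 a8 :: real
  assumes "c\<^sup>2 + s\<^sup>2 = 1"
  shows "(c\<^sup>2 * a4 + c * s * (a5 + a7) + s\<^sup>2 * a8) * (s\<^sup>2 * a4 - c * s * (a5 + a7) + c\<^sup>2 * a8) -
    (c\<^sup>2 * a5 - s\<^sup>2 * a7 + c * s * (a8 - a4)) * (c\<^sup>2 * a7 - s\<^sup>2 * a5 + c * s * (a8 - a4)) =
    a4 * a8 - a5 * a7" (is "?l = ?r")
proof -
  have "?l = (c\<^sup>2 + s\<^sup>2)\<^sup>2 * ?r" by algebra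
  then show ?thesis using assms by simp
qed

text \<open>Both sides are \<open>w \<bullet> A w\<close> at \<open>w = (a2, -a1)\<close>, computed
  in rotated and in original coordinates.\<close>

lemma rotated_focal_value:
  fixes a4 a5 a7 a8 :: real
  assumes "c\<^sup>2 + s\<^sup>2 = 1"
  shows "(c * a2 - s * a1)\<^sup>2 * (c\<^sup>2 * a4 + c * s * (a5 + a7) + s\<^sup>2 * a8) -
    (c * a1 + s * a2) * (c * a2 - s * a1) *
      ((c\<^sup>2 * a5 - s\<^sup>2 * a7 + c * s * (a8 - a4)) + (c\<^sup>2 * a7 - s\<^sup>2 * a5 + c * s * (a8 - a4))) +
    (c * a1 + s * a2)\<^sup>2 * (s\<^sup>2 * a4 - c * s * (a5 + a7) + c\<^sup>2 * a8) =
    a2\<^sup>2 * a4 - a1 * a2 * (a5 + a7) + a1\<^sup>2 * a8" (is "?l = ?r")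
proof -
  have "?l = (c\<^sup>2 + s\<^sup>2)\<^sup>2 * ?r" by algebra
  then show ?thesis using assms by simp
qed

text \<open>If \<open>a2 = 0\<close> the field vanishes on the plane \<open>x = 0\<close>, and if
  \<open>a7 = 0\<close> on the plane \<open>l = 0\<close>. Otherwise the signs required for the cusp
  are arranged by the half turn, which negates only \<open>a1\<close> and \<open>a2\<close>, and by
  time reversal, which negates everything.\<close>

lemma not_center_nilpotent:
  "\<not> sphere_center (quadratic_field a1 a2 0 0 a7 0) south_pole"
proof -
  obtain L where L: "L-lipschitz_on unit_sphere (quadratic_field a1 a2 0 0 a7 0)"
    by (rule quadratic_field_sphere_lipschitz)
  consider "a2 = 0" | "a7 = 0" | "a2 \<noteq> 0" "a7 \<noteq> 0" by blast
  then show ?thesis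
  proof cases
    case 1
    then show ?thesis
      by (intro not_center_singular_direction[OF L, of 0 1]) (simp_all add: vec3_eq_iff)
  next
    case 2
    obtain c s where cs: "c\<^sup>2 + s\<^sup>2 = 1" "c * a1 + s * a2 = 0" by (rule kernel_direction)
    have "a1 * (c * t) * (s * t) + a2 * (s * t)\<^sup>2 = (s * t) * t * (c * a1 + s * a2)"
      "- a1 * (c * t)\<^sup>2 - a2 * (c * t) * (s * t) = - (c * t) * t * (c * a1 + s * a2)" for t
      by (simp_all add: power2_eq_square algebra_simps)
    then show ?thesis
      using 2 cs by (intro not_center_singular_direction[OF L cs(1)]) (simp add: vec3_eq_iff)
  next
    case 3
    have "\<not> sphere_center (quadratic_field b1 b2 0 0 b7 0) south_pole" if "b7 > 0" "b2 \<noteq> 0" for b1 b2 b7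
    proof (cases "b2 < 0")
      case True
      then show ?thesis using not_center_cusp that by blast
    next
      case False
      then have "\<not> sphere_center (quadratic_field (- b1) (- b2) 0 0 b7 0) south_pole"
        using not_center_cusp[of b7 "- b2"] that by simp
      then show ?thesis using sphere_center_rotate[of "-1" 0 b1 b2 0 0 b7 0] by simp
    qed
    from this[of a7 a2 a1] this[of "- a7" "- a2" "- a1"] show ?thesis
      using 3 sphere_center_uminus_quadratic_field[of a1 a2 0 0 a7 0 south_pole]
      by (cases "a7 > 0") auto
  qed
qed

lemma not_center_det_nonpos:
  assumes det: "a4 * a8 - a5 * a7 \<le> 0"
  shows "\<not> sphere_center (quadratic_field a1 a2 a4 a5 a7 a8) south_pole"
proof -
  have *: "\<not> sphere_center (quadratic_field a1 a2 a4 a5 a7 a8) south_pole"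
    if det: "a4 * a8 - a5 * a7 \<le> 0" and tr: "a4 + a8 \<ge> 0" for a1 a2 a4 a5 a7 a8
  proof -
    define D where "D = sqrt ((a4 + a8)\<^sup>2 - 4 * (a4 * a8 - a5 * a7))"
    \<comment> \<open>The larger eigenvalue of \<open>A\<close>. With nonpositive determinant and
      nonnegative trace it is positive and simple, unless \<open>D\<close> and the trace both vanish
      and \<open>A\<close> is nilpotent.\<close>
    define \<mu> where "\<mu> = (a4 + a8 + D) / 2"
    have "4 * (a4 * a8 - a5 * a7) \<le> 0" using det by simp
    also have "0 \<le> (a4 + a8)\<^sup>2" by simp
    finally have nonneg: "0 \<le> (a4 + a8)\<^sup>2 - 4 * (a4 * a8 - a5 * a7)" by (simp only: diff_ge_0_iff_ge)
    then have D2: "D\<^sup>2 = (a4 + a8)\<^sup>2 - 4 * (a4 * a8 - a5 * a7)"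
      unfolding D_def by (intro real_sqrt_pow2)
    have D0: "D \<ge> 0" unfolding D_def by (rule real_sqrt_ge_zero[OF nonneg])
    have "4 * ((a4 - \<mu>) * (a8 - \<mu>)) = 4 * (a5 * a7)"
      using D2 by (simp add: \<mu>_def power2_eq_square field_simps)
    then obtain c s where cs: "c\<^sup>2 + s\<^sup>2 = 1" "c * a4 + s * a7 = c * \<mu>" "c * a5 + s * a8 = s * \<mu>"
      using left_eigenvector[of a4 \<mu> a8 a5 a7] by auto
    have "c\<^sup>2 * a4 + c * s * (a5 + a7) + s\<^sup>2 * a8 = c * (c * a4 + s * a7) + s * (c * a5 + s * a8)"
      by (simp add: power2_eq_square algebra_simps)
    also have "\<dots> = (c\<^sup>2 + s\<^sup>2) * \<mu>" unfolding cs(2,3) by (simp add: power2_eq_square algebra_simps)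
    finally have r4: "c\<^sup>2 * a4 + c * s * (a5 + a7) + s\<^sup>2 * a8 = \<mu>" using cs by simp
    have "c\<^sup>2 * a5 - s\<^sup>2 * a7 + c * s * (a8 - a4) = c * (c * a5 + s * a8) - s * (c * a4 + s * a7)"
      by (simp add: power2_eq_square algebra_simps)
    also have "\<dots> = 0" unfolding cs(2,3) by (simp add: algebra_simps)
    finally have r5: "c\<^sup>2 * a5 - s\<^sup>2 * a7 + c * s * (a8 - a4) = 0" .
    have "(s\<^sup>2 * a4 - c * s * (a5 + a7) + c\<^sup>2 * a8) + (c\<^sup>2 * a4 + c * s * (a5 + a7) + s\<^sup>2 * a8) =
        (c\<^sup>2 + s\<^sup>2) * (a4 + a8)"
      by (simp add: algebra_simps)
    then have r8: "s\<^sup>2 * a4 - c * s * (a5 + a7) + c\<^sup>2 * a8 = a4 + a8 - \<mu>"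
      using r4 cs by simp
    define a7' where "a7' = c\<^sup>2 * a7 - s\<^sup>2 * a5 + c * s * (a8 - a4)"
    have "\<not> sphere_center (quadratic_field (c * a1 + s * a2) (c * a2 - s * a1) \<mu> 0 a7' (a4 + a8 - \<mu>)) south_pole"
    proof (cases "D = 0 \<and> a4 + a8 = 0")
      case True
      then show ?thesis using not_center_nilpotent by (simp add: \<mu>_def)
    next
      case False
      have "D \<noteq> 0"
      proof
        assume "D = 0"
        then have "(a4 + a8)\<^sup>2 \<le> 0" using D2 det by simp
        then show False using False \<open>D = 0\<close> by simp
      qed
      then have "\<mu> > 0" "\<mu> > a4 + a8 - \<mu>" using D0 tr by (auto simp: \<mu>_def field_simps)
      then show ?thesis by (rule not_center_real_eigenvalues)
    qed
    then show ?thesis using sphere_center_rotate[OF cs(1), of a1 a2 a4 a5 a7 a8] unfolding r4 r5 r8 a7'_def by blast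
  qed
  show ?thesis
  proof (cases "a4 + a8 \<ge> 0")
    case False
    then have "\<not> sphere_center (quadratic_field (-a1) (-a2) (-a4) (-a5) (-a7) (-a8)) south_pole"
      using det by (intro *) auto
    then show ?thesis using sphere_center_uminus_quadratic_field by blast
  qed (use * det in blast)
qed

lemma not_center_trace:
  assumes tr: "a4 + a8 \<noteq> 0" and det: "a4 * a8 - a5 * a7 > 0"
  shows "\<not> sphere_center (quadratic_field a1 a2 a4 a5 a7 a8) south_pole"
proof (cases "a4 + a8 > 0")
  case False
  then have "\<not> sphere_center (quadratic_field (-a1) (-a2) (-a4) (-a5) (-a7) (-a8)) south_pole"
    using tr det by (intro not_center_trace_pos) auto
  then show ?thesis using sphere_center_uminus_quadratic_field by blast
qed (use not_center_trace_pos det in blast)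

text \<open>Time reversal exchanges the sign patterns \<open>a5 < 0 < a7\<close> and
  \<open>a7 < 0 < a5\<close>, the two senses of rotation around the pole.\<close>

lemma center_antidiagonal:
  assumes "a5 * a7 < 0"
  shows "sphere_center (quadratic_field a1 a2 0 a5 a7 0) south_pole \<Longrightarrow> a1 * a2 * (a5 + a7) = 0"
    and "sphere_center (quadratic_field 0 a2 0 a5 a7 0) south_pole"
proof -
  consider "a5 < 0" "a7 > 0" | "a5 > 0" "a7 < 0"
    using assms by (auto simp: mult_less_0_iff)
  then have "(sphere_center (quadratic_field a1 a2 0 a5 a7 0) south_pole \<longrightarrow> a1 * a2 * (a5 + a7) = 0) \<and>
      sphere_center (quadratic_field 0 a2 0 a5 a7 0) south_pole"
  proof cases
    case 1
    then show ?thesis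
      using not_center_weak_focus[of "- a5" a7 a1 a2] reversible_center[of "- a5" a7 a2]
      by (auto simp: add.commute)
  next
    case 2
    have "- a1 * - a2 * (- a7 - a5) = - (a1 * a2 * (a5 + a7))" by (simp add: algebra_simps)
    then have "a1 * a2 * (a5 + a7) = 0" if "sphere_center (quadratic_field a1 a2 0 a5 a7 0) south_pole"
      using not_center_weak_focus[of a5 "- a7" "- a1" "- a2"] 2
        sphere_center_uminus_quadratic_field[OF that] by (metis neg_0_equal_iff_equal neg_0_less_iff_less)
    moreover have "sphere_center (quadratic_field 0 a2 0 a5 a7 0) south_pole"
      using sphere_center_uminus_quadratic_field[OF reversible_center[of a5 "- a7" "- a2"]] 2 by simp
    ultimately show ?thesis by blast
  qed
  then show "sphere_center (quadratic_field a1 a2 0 a5 a7 0) south_pole \<Longrightarrow> a1 * a2 * (a5 + a7) = 0"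
    and "sphere_center (quadratic_field 0 a2 0 a5 a7 0) south_pole" by blast+
qed

lemma sphere_center_quadratic_field_iff:
  "sphere_center (quadratic_field a1 a2 a4 a5 a7 a8) south_pole \<longleftrightarrow>
    a8 = - a4 \<and> a4\<^sup>2 + a7 * a5 < 0 \<and> a4 * (a1\<^sup>2 - a2\<^sup>2) + a1 * a2 * (a5 + a7) = 0"
  (is "?center \<longleftrightarrow> ?tr \<and> ?det \<and> ?K")
proof -
  have "?tr \<and> ?det" if ?center
  proof -
    have "a4 * a8 - a5 * a7 > 0" using that not_center_det_nonpos not_le by blast
    then have "a4 + a8 = 0" using that not_center_trace by blast
    then have "a8 = - a4" by simp
    then show ?thesis using \<open>a4 * a8 - a5 * a7 > 0\<close> by (simp add: power2_eq_square mult.commute)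
  qed
  moreover have "?center \<longleftrightarrow> ?K" if tr: ?tr and det: ?det
  proof -
    have K: "?K \<longleftrightarrow> a2\<^sup>2 * a4 - a1 * a2 * (a5 + a7) + a1\<^sup>2 * a8 = 0"
      unfolding tr by (auto simp: algebra_simps)
    have det': "a4 * a8 - a5 * a7 > 0" using tr det by (simp add: power2_eq_square mult.commute)
    have rotated: "?center \<longleftrightarrow>
        sphere_center (quadratic_field (c * a1 + s * a2) (c * a2 - s * a1) 0 a5' a7' 0) south_pole \<and>
        a5' * a7' < 0 \<and>
        a2\<^sup>2 * a4 - a1 * a2 * (a5 + a7) + a1\<^sup>2 * a8 = - ((c * a1 + s * a2) * (c * a2 - s * a1) * (a5' + a7'))"
      if cs: "c\<^sup>2 + s\<^sup>2 = 1" and 0: "c\<^sup>2 * a4 + c * s * (a5 + a7) - s\<^sup>2 * a4 = 0"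
        and a': "a5' = c\<^sup>2 * a5 - s\<^sup>2 * a7 + c * s * (a8 - a4)"
          "a7' = c\<^sup>2 * a7 - s\<^sup>2 * a5 + c * s * (a8 - a4)" for c s a5' a7'
    proof -
      have r: "c\<^sup>2 * a4 + c * s * (a5 + a7) + s\<^sup>2 * a8 = 0" "s\<^sup>2 * a4 - c * s * (a5 + a7) + c\<^sup>2 * a8 = 0"
        using 0 unfolding tr by (simp_all add: algebra_simps)
      show ?thesis
        using sphere_center_rotate[OF cs, of a1 a2 a4 a5 a7 a8] rotated_det[OF cs, of a4 a5 a7 a8]
          rotated_focal_value[OF cs, of a2 a1 a4 a5 a7 a8] det'
        unfolding r a'[symmetric] by auto
    qed
    show ?thesis
    proof
      assume c: ?center
      obtain c s where cs: "c\<^sup>2 + s\<^sup>2 = 1" "c\<^sup>2 * a4 + c * s * (a5 + a7) - s\<^sup>2 * a4 = 0"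
        by (rule isotropic_direction)
      note r = rotated[OF cs refl refl, THEN iffD1, OF c]
      show ?K
        unfolding K r[THEN conjunct2, THEN conjunct2]
          center_antidiagonal(1)[OF r[THEN conjunct2, THEN conjunct1] r[THEN conjunct1]] by simp
    next
      assume ?K
      \<comment> \<open>This rotation must remove \<open>a1\<close> as well. A vector orthogonal to
        \<open>(a1, a2)\<close> is proportional to \<open>(a2, -a1)\<close>, and \<open>?K\<close>
        says precisely that this direction is isotropic; if \<open>a1 = a2 = 0\<close>, every
        isotropic direction serves.\<close>
      obtain c s where cs: "c\<^sup>2 + s\<^sup>2 = 1" "c * a1 + s * a2 = 0"
        and 0: "c\<^sup>2 * a4 + c * s * (a5 + a7) - s\<^sup>2 * a4 = 0"
      proof (cases "a1 = 0 \<and> a2 = 0")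
        case True
        then show ?thesis using that isotropic_direction[of a4 "a5 + a7"] by auto
      next
        case False
        obtain c s where cs: "c\<^sup>2 + s\<^sup>2 = 1" "c * a1 + s * a2 = 0" by (rule kernel_direction)
        have "a1\<^sup>2 * (c\<^sup>2 * a4 + c * s * (a5 + a7) - s\<^sup>2 * a4) = 0"
          "a2\<^sup>2 * (c\<^sup>2 * a4 + c * s * (a5 + a7) - s\<^sup>2 * a4) = 0"
          using cs(2) \<open>?K\<close> by algebra+
        then have "c\<^sup>2 * a4 + c * s * (a5 + a7) - s\<^sup>2 * a4 = 0" using False by auto
        then show ?thesis using that cs by blast
      qed
      have "\<not> a5' * a7' < 0 \<or> sphere_center (quadratic_field 0 b 0 a5' a7' 0) south_pole" for a5' a7' b
        using center_antidiagonal(2) by blast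
      moreover have "(c\<^sup>2 * a5 - s\<^sup>2 * a7 + c * s * (a8 - a4)) * (c\<^sup>2 * a7 - s\<^sup>2 * a5 + c * s * (a8 - a4)) < 0"
      proof -
        have "c\<^sup>2 * a4 + c * s * (a5 + a7) + s\<^sup>2 * a8 = 0" using 0 unfolding tr by simp
        then show ?thesis using rotated_det[OF cs(1), of a4 a5 a7 a8] det' by simp
      qed
      ultimately show ?center
        using rotated[OF cs(1) 0 refl refl] cs(2) \<open>?K\<close>[unfolded K] by simp
    qed
  qed
  ultimately show ?thesis by blast
qed

section \<open>Normal form of homogeneous quadratic fields singular at the pole\<close>

lemma homogeneous_polynomial3_2:
  assumes "homogeneous_polynomial3 2 f"
  obtains a b c d e g where "\<And>v. f v = a * (v $ 1)\<^sup>2 + b * v $ 1 * v $ 2 + c * v $ 1 * v $ 3 +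
    d * (v $ 2)\<^sup>2 + e * v $ 2 * v $ 3 + g * (v $ 3)\<^sup>2"
proof -
  obtain k where k: "\<And>v. f v = (\<Sum>(i, j, l) \<in> {(i, j, l). i + j + l = 2}.
      k i j l * (v $ 1) ^ i * (v $ 2) ^ j * (v $ 3) ^ l)"
    using assms unfolding homogeneous_polynomial3_def by blast
  have cases: "(i, j, l) \<in> {(2,0,0), (1,1,0), (1,0,1), (0,2,0), (0,1,1), (0,0,2)}" if "i + j + l = 2" for i j l :: nat
  proof -
    have "i = 0 \<or> i = 1 \<or> i = 2" "j = 0 \<or> j = 1 \<or> j = 2" "l = 2 - i - j" using that by linarith+
    then show ?thesis using that by (elim disjE) simp_all
  qed
  have "{(i, j, l). i + j + l = (2::nat)} \<subseteq> {(2,0,0), (1,1,0), (1,0,1), (0,2,0), (0,1,1), (0,0,2)}"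
  proof
    fix x :: "nat \<times> nat \<times> nat" assume x: "x \<in> {(i, j, l). i + j + l = 2}"
    obtain i j l where ijl: "x = (i, j, l)" by (rule prod_cases3)
    show "x \<in> {(2,0,0), (1,1,0), (1,0,1), (0,2,0), (0,1,1), (0,0,2)}"
      unfolding ijl by (rule cases) (use x ijl in simp)
  qed
  moreover have "{(2,0,0), (1,1,0), (1,0,1), (0,2,0), (0,1,1), (0,0,2)} \<subseteq> {(i, j, l). i + j + l = (2::nat)}"
    by simp
  ultimately have S: "{(i, j, l). i + j + l = (2::nat)} = {(2,0,0), (1,1,0), (1,0,1), (0,2,0), (0,1,1), (0,0,2)}"
    by (rule equalityI)
  have "f v = k 2 0 0 * (v $ 1)\<^sup>2 + k 1 1 0 * v $ 1 * v $ 2 + k 1 0 1 * v $ 1 * v $ 3 +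
      k 0 2 0 * (v $ 2)\<^sup>2 + k 0 1 1 * v $ 2 * v $ 3 + k 0 0 2 * (v $ 3)\<^sup>2" for v
    unfolding k S by simp
  then show ?thesis by (rule that)
qed

text \<open>Homogeneity extends tangency from the unit sphere to the whole space, so the cubic
  \<open>v \<bullet> X v\<close> vanishes identically. Evaluating it at points with coordinates 0, 1
  and -1 isolates the relations between the coefficients; the singularity removes the
  \<open>z\<^sup>2\<close> terms.\<close>

lemma homogeneous_field_form:
  assumes X: "homogeneous_vector_field_on_sphere 2 X" and sing: "X south_pole = 0"
  shows "\<exists>a1 a2 a4 a5 a7 a8. X = quadratic_field a1 a2 a4 a5 a7 a8"
proof -
  have poly: "homogeneous_polynomial3 2 (\<lambda>v. X v $ i)" for i
    using X by (simp add: homogeneous_vector_field_on_sphere_def)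
  obtain p1 p2 p3 p4 p5 p6 where P: "\<And>v. X v $ 1 = p1 * (v $ 1)\<^sup>2 + p2 * v $ 1 * v $ 2 + p3 * v $ 1 * v $ 3 +
      p4 * (v $ 2)\<^sup>2 + p5 * v $ 2 * v $ 3 + p6 * (v $ 3)\<^sup>2"
    using homogeneous_polynomial3_2[OF poly[of 1]] by blast
  obtain q1 q2 q3 q4 q5 q6 where Q: "\<And>v. X v $ 2 = q1 * (v $ 1)\<^sup>2 + q2 * v $ 1 * v $ 2 + q3 * v $ 1 * v $ 3 +
      q4 * (v $ 2)\<^sup>2 + q5 * v $ 2 * v $ 3 + q6 * (v $ 3)\<^sup>2"
    using homogeneous_polynomial3_2[OF poly[of 2]] by blast
  obtain r1 r2 r3 r4 r5 r6 where R: "\<And>v. X v $ 3 = r1 * (v $ 1)\<^sup>2 + r2 * v $ 1 * v $ 2 + r3 * v $ 1 * v $ 3 +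
      r4 * (v $ 2)\<^sup>2 + r5 * v $ 2 * v $ 3 + r6 * (v $ 3)\<^sup>2"
    using homogeneous_polynomial3_2[OF poly[of 3]] by blast
  have scale: "X (k *\<^sub>R v) = k\<^sup>2 *\<^sub>R X v" for k v
    by (simp add: vec3_eq_iff P Q R power2_eq_square algebra_simps)
  have tangent: "v \<bullet> X v = 0" for v
  proof (cases "v = 0")
    case False
    define u where "u = (1 / norm v) *\<^sub>R v"
    have "u \<in> unit_sphere" "v = norm v *\<^sub>R u" using False by (simp_all add: u_def)
    then have "u \<bullet> X u = 0" using X by (simp add: homogeneous_vector_field_on_sphere_def)
    then have "(norm v *\<^sub>R u) \<bullet> X (norm v *\<^sub>R u) = 0" unfolding scale by simp
    then show ?thesis using \<open>v = norm v *\<^sub>R u\<close> by simp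
  qed simp
  have T: "x * (p1 * x\<^sup>2 + p2 * x * y + p3 * x * z + p4 * y\<^sup>2 + p5 * y * z + p6 * z\<^sup>2) +
      y * (q1 * x\<^sup>2 + q2 * x * y + q3 * x * z + q4 * y\<^sup>2 + q5 * y * z + q6 * z\<^sup>2) +
      z * (r1 * x\<^sup>2 + r2 * x * y + r3 * x * z + r4 * y\<^sup>2 + r5 * y * z + r6 * z\<^sup>2) = 0" for x y z
    using tangent[of "vector [x, y, z]"] by (simp add: inner_vec3 P Q R)
  have z2: "p6 = 0" "q6 = 0" "r6 = 0"
    using sing P[of south_pole] Q[of south_pole] R[of south_pole] by simp_all
  have x2: "p1 = 0" "q4 = 0" using T[of 1 0 0] T[of 0 1 0] by simp_all
  have xy: "q1 = - p2" "q2 = - p4"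
    using T[of 1 1 0] T[of 1 "-1" 0] x2 by simp_all
  have xz: "r1 = - p3" "r3 = 0" using T[of 1 0 1] T[of 1 0 "-1"] x2 z2 by simp_all
  have yz: "r4 = - q5" "r5 = 0" using T[of 0 1 1] T[of 0 1 "-1"] x2 z2 by simp_all
  have xyz: "r2 = - (p5 + q3)" using T[of 1 1 1] x2 z2 xy xz yz by simp
  have "X v = quadratic_field p2 p4 p3 p5 q3 q5 v" for v
    unfolding vec3_eq_iff quadratic_field_component P Q R x2 z2 xy xz yz xyz
    by (simp add: algebra_simps)
  then show ?thesis by blast
qed

text \<open>The first conjunct guarantees that the second is not vacuous; the second holds for
  whichever coefficients represent \<open>X\<close>.\<close>

theorem theorem2:
  fixes X :: "real ^ 3 \<Rightarrow> real ^ 3" and p :: "real ^ 3"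
  assumes "p = vector [0, 0, -1]"
    and "homogeneous_vector_field_on_sphere 2 X"
    and "sphere_singularity X p"
  shows "(\<exists>a1 a2 a4 a5 a7 a8. X = quadratic_field a1 a2 a4 a5 a7 a8) \<and>
         (\<forall>a1 a2 a4 a5 a7 a8. X = quadratic_field a1 a2 a4 a5 a7 a8 \<longrightarrow>
            (sphere_center X p \<longleftrightarrow>
               a8 = - a4 \<and> a4\<^sup>2 + a7 * a5 < 0 \<and>
               a4 * (a1\<^sup>2 - a2\<^sup>2) + a1 * a2 * (a5 + a7) = 0))"
proof (intro conjI allI impI)
  have "X south_pole = 0" using assms(1,3) by (simp add: sphere_singularity_def)
  then show "\<exists>a1 a2 a4 a5 a7 a8. X = quadratic_field a1 a2 a4 a5 a7 a8"
    by (rule homogeneous_field_form[OF assms(2)])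
next
  fix a1 a2 a4 a5 a7 a8
  assume X: "X = quadratic_field a1 a2 a4 a5 a7 a8"
  show "sphere_center X p \<longleftrightarrow> a8 = - a4 \<and> a4\<^sup>2 + a7 * a5 < 0 \<and>
      a4 * (a1\<^sup>2 - a2\<^sup>2) + a1 * a2 * (a5 + a7) = 0"
    unfolding X assms(1) by (rule sphere_center_quadratic_field_iff)
qed

end
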